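(* Let $m \in \mathbb{N}$ (i.e. $m\ge1$) and let $p\colon U\mathbb{S}^{4m-1}\to \mathbb{S}^{4m-1}$ be the unit tangent bundle of the standard sphere $\mathbb{S}^{4m-1}\subset \mathbb{R}^{4m}$. Then for all $r \in \mathbb{N}$ with $r\geq 2$ it holds that $$\mathsf{TC}_r[p\colon U\mathbb{S}^{4m-1}\to \mathbb{S}^{4m-1}] = r + 1.$$
   Context: $U\mathbb{S}^{4m-1}=\{(x,v)\in\mathbb{S}^{4m-1}\times\mathbb{R}^{4m}\mid\langle x,v\rangle=0,\ \langle v,v\rangle=1\}$ and $p(x,v)=x$. For a fibration $p\colon E\to X$ with path-connected fibers and $r\ge2$ put $E^r_X=\{(u_1,\dots,u_r)\in E^r\mid p(u_1)=\dots=p(u_r)\}$, $E^I_X=\{\gamma\in C^0([0,1],E)\mid p(\gamma(t))=p(\gamma(0))\ \forall t\}$ (compact-open topology) and $\Pi_r\colon E^I_X\to E^r_X$, $\Pi_r(\gamma)=(\gamma(0),\gamma(\tfrac1{r-1}),\dots,\gamma(\tfrac{r-2}{r-1}),\gamma(1))$. The $r$-th sequential parametrized topological complexity $\mathsf{TC}_r[p\colon E\to X]$ is the smallest $k\in\mathbb{N}$ such that there is an open cover $U_1,\dots,U_k$ of $E^r_X$ with each $U_i$ admitting a continuous local section of $\Pi_r$ (unreduced convention). *)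

theory Defs
  imports "HOL-Analysis.Analysis" "HOL-Library.Extended_Nat"
begin

section \<open>Fibre products and fibrewise path spaces\<close>

text \<open>
  The fibre product \<open>E\<^sup>r\<^sub>X\<close> of a map \<open>p : E \<rightarrow> X\<close>, with the subspace topology of the \<open>r\<close>-fold
  product.  The entries \<open>u\<^sub>1, \<dots>, u\<^sub>r\<close> of a tuple are indexed from zero, as \<open>u 0, \<dots>, u (r - 1)\<close>.
\<close>

definition fibre_power :: "nat \<Rightarrow> 'a topology \<Rightarrow> ('a \<Rightarrow> 'b) \<Rightarrow> (nat \<Rightarrow> 'a) topology" where
  "fibre_power r E p =
     subtopology (product_topology (\<lambda>i. E) {..<r}) {u. \<forall>i<r. \<forall>j<r. p (u i) = p (u j)}"

text \<open>
  Continuous paths \<open>[0,1] \<rightarrow> E\<close> are represented by functions on the reals that are \<open>undefined\<close>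
  outside \<open>[0,1]\<close>, so that equality of paths is equality of functions.
\<close>

definition path_set :: "'a topology \<Rightarrow> (real \<Rightarrow> 'a) set" where
  "path_set E = {\<gamma> \<in> extensional {0..1}. pathin E \<gamma>}"

definition path_space :: "'a topology \<Rightarrow> (real \<Rightarrow> 'a) topology" where
  "path_space E =
     topology_generated_by
       {{\<gamma> \<in> path_set E. \<gamma> ` K \<subseteq> V} | K V. compact K \<and> K \<subseteq> {0..1} \<and> openin E V}"

lemma topspace_path_space: "topspace (path_space E) = path_set E"
proof -
  have "path_set E \<in> {{\<gamma> \<in> path_set E. \<gamma> ` K \<subseteq> V} | K V. compact K \<and> K \<subseteq> {0..1} \<and> openin E V}"
    by (rule CollectI, rule exI[of _ "{}"], rule exI[of _ "{}"]) auto
  then show ?thesis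
    unfolding path_space_def topology_generated_by_topspace by blast
qed

definition fibre_path_space :: "'a topology \<Rightarrow> ('a \<Rightarrow> 'b) \<Rightarrow> (real \<Rightarrow> 'a) topology" where
  "fibre_path_space E p =
     subtopology (path_space E) {\<gamma>. \<forall>t\<in>{0..1}. p (\<gamma> t) = p (\<gamma> 0)}"

definition fibre_path_eval :: "nat \<Rightarrow> (real \<Rightarrow> 'a) \<Rightarrow> nat \<Rightarrow> 'a" where
  "fibre_path_eval r \<gamma> = (\<lambda>i\<in>{..<r}. \<gamma> (real i / real (r - 1)))"


section \<open>Sequential parametrized topological complexity\<close>

definition has_local_section ::
    "nat \<Rightarrow> 'a topology \<Rightarrow> ('a \<Rightarrow> 'b) \<Rightarrow> (nat \<Rightarrow> 'a) set \<Rightarrow> bool" where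
  "has_local_section r E p U \<longleftrightarrow>
     (\<exists>s. continuous_map (subtopology (fibre_power r E p) U) (fibre_path_space E p) s \<and>
          (\<forall>u\<in>U. fibre_path_eval r (s u) = u))"

text \<open>
  This is the unreduced convention: the number of open sets is counted, so it is at least one.  The
  value is \<open>\<infinity>\<close> if no finite cover with local sections exists.  The base space enters only through
  the equality of values of \<open>p\<close>.
\<close>

definition seq_param_TC :: "nat \<Rightarrow> 'a topology \<Rightarrow> ('a \<Rightarrow> 'b) \<Rightarrow> enat" where
  "seq_param_TC r E p =
     Inf {enat k | k. 1 \<le> k \<and>
       (\<exists>U :: nat \<Rightarrow> (nat \<Rightarrow> 'a) set.
          (\<forall>i\<in>{1..k}. openin (fibre_power r E p) (U i) \<and> has_local_section r E p (U i)) \<and>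
          (\<Union>i\<in>{1..k}. U i) = topspace (fibre_power r E p))}"


section \<open>The unit tangent bundle of the standard sphere\<close>

definition unit_tangent_sphere :: "((real ^ 'n) \<times> (real ^ 'n)) set" where
  "unit_tangent_sphere = {(x, v). x \<in> sphere 0 1 \<and> x \<bullet> v = 0 \<and> v \<bullet> v = 1}"

definition unit_tangent_proj :: "(real ^ 'n) \<times> (real ^ 'n) \<Rightarrow> real ^ 'n" where
  "unit_tangent_proj = (\<lambda>(x, v). x)"

lemma unit_tangent_proj_continuous:
  "continuous_map (top_of_set unit_tangent_sphere) (top_of_set (sphere 0 1)) unit_tangent_proj"
  by (auto simp: unit_tangent_proj_def unit_tangent_sphere_def case_prod_unfold
      intro!: continuous_intros)

end

theory Submission
  imports Defs "HOL-Homology.Homology"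
begin

text \<open>
  Lower bound. On a fibre, a cover by \<open>r\<close> open sets with local sections gives \<open>r\<close> open sets covering
  the \<open>r\<close>-th power of an even-dimensional sphere, on each of which all projections are homotopic. Regard the
  sphere as the directions in an odd-dimensional space \<open>W\<close> and let \<open>w\<^sub>0, \<dots>, w\<^sub>r\<^sub>-\<^sub>1\<close> range over \<open>W\<close>. Using the
  \<open>k\<close>-th homotopy while \<open>1 \<le> \<bar>w\<^sub>k\<bar> \<le> 2\<close>, build a map \<open>f\<^sub>k\<close> that is the direction of \<open>w\<^sub>k\<close> when \<open>\<bar>w\<^sub>k\<bar> \<ge> 2\<close> and
  is \<open>w\<^sub>0\<close> (respectively \<open>w\<^sub>1\<close>, if \<open>k = 0\<close>) clipped to the unit ball when \<open>\<bar>w\<^sub>k\<bar> \<le> 1\<close>. Because the open sets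
  cover, the map \<open>(f\<^sub>1, f\<^sub>0, f\<^sub>2, \<dots>)\<close>, corrected near \<open>w\<^sub>0 = 0\<close>, vanishes only at the origin. On the unit
  sphere of \<open>W\<^sup>r\<close> it is homotopic to the identity, on a large sphere to the exchange of \<open>w\<^sub>0\<close> and \<open>w\<^sub>1\<close>, whose
  degree is \<open>-1\<close> because \<open>W\<close> has odd dimension.

  Upper bound. Multiplication by quaternion units gives two orthogonal tangent fields \<open>I x\<close>, \<open>J x\<close>. A path
  from \<open>v\<^sub>0\<close> to \<open>v\<^sub>j\<close> needs the choice whether to start at \<open>v\<^sub>0\<close> or at \<open>- v\<^sub>0\<close> for each \<open>j \<ge> 1\<close>, and the choice
  of \<open>I\<close> or \<open>J\<close> to get from \<open>v\<^sub>0\<close> to \<open>- v\<^sub>0\<close>: these are \<open>r\<close> binary choices, each governed by a function with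
  values in \<open>[0,1]\<close>, and the sets \<open>S\<close> of choices of a given size lead to disjoint open domains.
\<close>

section \<open>Brouwer degree\<close>

text \<open>The carrier of the library sphere \<open>nsphere p\<close>, kept as a set of functions
  so that \<open>continuous_on\<close> and the type-class topology apply to maps on it.\<close>

definition unit_nsphere :: "nat \<Rightarrow> (nat \<Rightarrow> real) set" where
  "unit_nsphere p = {x. (\<Sum>i\<le>p. (x i)\<^sup>2) = 1 \<and> (\<forall>i>p. x i = 0)}"

lemma nsphere_eq_top_of_set: "nsphere p = top_of_set (unit_nsphere p)"
  by (simp add: nsphere euclidean_product_topology unit_nsphere_def)

definition normalise :: "nat \<Rightarrow> (nat \<Rightarrow> real) \<Rightarrow> nat \<Rightarrow> real" where
  "normalise p y = (\<lambda>i. if i \<le> p then y i / sqrt (\<Sum>j\<le>p. (y j)\<^sup>2) else 0)"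

lemma normalise_in_unit_nsphere:
  assumes "\<exists>i\<le>p. y i \<noteq> 0"
  shows "normalise p y \<in> unit_nsphere p"
proof -
  have pos: "(\<Sum>j\<le>p. (y j)\<^sup>2) > 0"
    using assms by (auto intro!: sum_pos2)
  then show ?thesis
    by (simp add: unit_nsphere_def normalise_def power_divide sum_nonneg flip: sum_divide_distrib)
qed

lemma normalise_eq_self:
  assumes "x \<in> unit_nsphere p"
  shows "normalise p x = x"
  using assms by (auto simp: unit_nsphere_def normalise_def fun_eq_iff not_le)

text \<open>Radial projection turns a homotopy that never vanishes into a homotopy of self-maps of
  the sphere. Degrees can thus be compared along linear homotopies, with no control of norms beyond
  being nonzero.\<close>

lemma Brouwer_degree2_normalise_homotopy:
  fixes H :: "real \<times> (nat \<Rightarrow> real) \<Rightarrow> nat \<Rightarrow> real"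
  assumes cont: "continuous_on ({0..1} \<times> unit_nsphere p) H"
    and nz: "\<And>t x. \<lbrakk>t \<in> {0..1}; x \<in> unit_nsphere p\<rbrakk> \<Longrightarrow> \<exists>i\<le>p. H (t, x) i \<noteq> 0"
  shows "Brouwer_degree2 p (\<lambda>x. normalise p (H (0, x))) = Brouwer_degree2 p (\<lambda>x. normalise p (H (1, x)))"
proof (rule Brouwer_degree2_homotopic)
  have pos: "(\<Sum>j\<le>p. (H (t, x) j)\<^sup>2) > 0" if "t \<in> {0..1}" "x \<in> unit_nsphere p" for t x
    using nz[OF that] by (auto intro!: sum_pos2)
  have comp: "continuous_on ({0..1} \<times> unit_nsphere p) (\<lambda>z. H z i)" for i
    using cont by (rule continuous_on_product_then_coordinatewise)
  have "continuous_on ({0..1} \<times> unit_nsphere p) (\<lambda>z. normalise p (H z))"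
    unfolding normalise_def
  proof (intro continuous_on_coordinatewise_then_product)
    fix i
    show "continuous_on ({0..1} \<times> unit_nsphere p) (\<lambda>z. if i \<le> p then H z i / sqrt (\<Sum>j\<le>p. (H z j)\<^sup>2) else 0)"
    proof (cases "i \<le> p")
      case True
      have "sqrt (\<Sum>j\<le>p. (H z j)\<^sup>2) \<noteq> 0" if "z \<in> {0..1} \<times> unit_nsphere p" for z
      proof -
        have "(\<Sum>j\<le>p. (H (fst z, snd z) j)\<^sup>2) > 0"
          by (rule pos) (use that in \<open>auto simp: mem_Times_iff\<close>)
        then show ?thesis by simp
      qed
      then have "continuous_on ({0..1} \<times> unit_nsphere p) (\<lambda>z. H z i / sqrt (\<Sum>j\<le>p. (H z j)\<^sup>2))"
        by (intro continuous_on_divide comp continuous_on_real_sqrt continuous_on_sum continuous_on_power) blast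
      then show ?thesis using True by simp
    qed simp
  qed
  moreover have "normalise p (H z) \<in> unit_nsphere p" if "z \<in> {0..1} \<times> unit_nsphere p" for z
    using nz[of "fst z" "snd z"] that by (intro normalise_in_unit_nsphere) (simp add: mem_Times_iff)
  then have "(\<lambda>z. normalise p (H z)) \<in> {0..1} \<times> unit_nsphere p \<rightarrow> unit_nsphere p"
    by (rule Pi_I)
  ultimately have "continuous_map (top_of_set ({0..1} \<times> unit_nsphere p)) (top_of_set (unit_nsphere p)) (\<lambda>z. normalise p (H z))"
    by (simp only: continuous_map_subtopology_eu)
  then show "homotopic_with (\<lambda>x. True) (nsphere p) (nsphere p)
      (\<lambda>x. normalise p (H (0, x))) (\<lambda>x. normalise p (H (1, x)))"
    unfolding homotopic_with_def nsphere_eq_top_of_set prod_topology_subtopology_eu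
    by (intro exI[of _ "\<lambda>z. normalise p (H z)"] conjI allI ballI TrueI refl)
qed

text \<open>The reflection in coordinate \<open>k\<close> is conjugate, by a transposition of
  coordinates, to the reflection in coordinate 0. The degree of the transposition enters twice, and
  its square is 1 because the transposition is an involution.\<close>

lemma Brouwer_degree2_reflection_coord:
  assumes "k \<le> p"
  shows "Brouwer_degree2 p (\<lambda>x i. if i = k then - x i else x i) = - 1"
proof -
  let ?r = "\<lambda>j x i. if i = j then - x i else x i :: real"
  let ?s = "\<lambda>x::nat \<Rightarrow> real. x \<circ> Transposition.transpose 0 k"
  have s: "continuous_map (nsphere p) (nsphere p) ?s"
  proof -
    have "x \<circ> Transposition.transpose 0 k \<in> unit_nsphere p" if x: "x \<in> unit_nsphere p" for x
    proof -
      have "(\<Sum>i\<le>p. (x (Transposition.transpose 0 k i))\<^sup>2) = (\<Sum>i\<le>p. (x i)\<^sup>2)"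
        using assms by (intro sum.reindex_bij_witness[of _ "Transposition.transpose 0 k" "Transposition.transpose 0 k"])
           (auto simp: Transposition.transpose_def)
      then show ?thesis using x assms by (auto simp: unit_nsphere_def Transposition.transpose_def)
    qed
    moreover have "continuous_on (unit_nsphere p) ?s"
      by (intro continuous_on_coordinatewise_then_product)
         (auto simp: o_def intro: continuous_on_product_then_coordinatewise)
    ultimately show ?thesis
      unfolding nsphere_eq_top_of_set by (auto simp: Pi_iff)
  qed
  have r0: "continuous_map (nsphere p) (nsphere p) (?r 0)"
    by (rule continuous_map_nsphere_reflection)
  have "?s \<circ> ?s = id"
    by (auto simp: fun_eq_iff Transposition.transpose_def)
  then have "Brouwer_degree2 p ?s * Brouwer_degree2 p ?s = 1"
    using Brouwer_degree2_compose[OF s s] by simp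
  moreover have "?r k = ?s \<circ> (?r 0 \<circ> ?s)"
    by (auto simp: fun_eq_iff Transposition.transpose_def)
  then have "Brouwer_degree2 p (?r k) = Brouwer_degree2 p ?s * (- 1 * Brouwer_degree2 p ?s)"
    using Brouwer_degree2_compose[OF continuous_map_compose[OF s r0] s]
      Brouwer_degree2_compose[OF s r0] Brouwer_degree2_reflection[of p] by simp
  ultimately show ?thesis by simp
qed

lemma Brouwer_degree2_reflect_initial:
  assumes "d \<le> Suc p"
  shows "Brouwer_degree2 p (\<lambda>x i. if i < d then - x i else x i) = (- 1) ^ d"
proof -
  \<comment> \<open>Continuity is carried through the induction because multiplicativity of the
    degree asks for it.\<close>
  have "Brouwer_degree2 p (\<lambda>x i. if i < d then - x i else x i) = (- 1) ^ d \<and>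
     continuous_map (nsphere p) (nsphere p) (\<lambda>x i. if i < d then - x i else x i)"
    using assms
  proof (induction d)
    case 0
    then show ?case using Brouwer_degree2_id by (simp add: id_def)
  next
    case (Suc d)
    let ?f = "\<lambda>x i. if i < d then - x i else x i :: real"
    let ?g = "\<lambda>x i. if i = d then - x i else x i :: real"
    have eq: "?g \<circ> ?f = (\<lambda>x i. if i < Suc d then - x i else x i)"
      by (auto simp: fun_eq_iff)
    have f: "continuous_map (nsphere p) (nsphere p) ?f" "Brouwer_degree2 p ?f = (- 1) ^ d"
      using Suc by auto
    have g: "continuous_map (nsphere p) (nsphere p) ?g"
      by (rule continuous_map_nsphere_reflection)
    have "Brouwer_degree2 p ?g = - 1"
      using Brouwer_degree2_reflection_coord[of d p] Suc.prems by simp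
    then show ?case
      using Brouwer_degree2_compose[OF f(1) g] continuous_map_compose[OF f(1) g] f(2)
      by (simp only: eq) simp
  qed
  then show ?thesis ..
qed

section \<open>Degree of maps on the unit sphere of \<open>r\<close> copies of a
  \<open>d\<close>-dimensional space\<close>

locale orthonormal_blocks =
  fixes r d :: nat and b :: "nat \<Rightarrow> 'a::euclidean_space"
  assumes r_pos: "r > 0" and d_pos: "d > 0"
    and orthonormal: "\<And>i j. \<lbrakk>i < d; j < d\<rbrakk> \<Longrightarrow> b i \<bullet> b j = of_bool (i = j)"
begin

abbreviation blk :: "'a set" where "blk \<equiv> span (b ` {..<d})"

text \<open>Here \<open>blk\<close> is the space W of the overview and tuples are functions on all
  of \<open>nat\<close>. Entries with index at least \<open>r\<close> are left
  unconstrained.\<close>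

definition block_sphere :: "(nat \<Rightarrow> 'a) set" where
  "block_sphere = {w. (\<forall>k<r. w k \<in> blk) \<and> (\<Sum>k<r. (norm (w k))\<^sup>2) = 1}"

text \<open>Coordinates of W^r in block order: position \<open>k * d + l\<close> holds coordinate
  \<open>l\<close> of entry \<open>k\<close>. The map \<open>dec\<close> goes back.\<close>

definition enc :: "(nat \<Rightarrow> 'a) \<Rightarrow> nat \<Rightarrow> real" where
  "enc w = (\<lambda>i. if i < r * d then w (i div d) \<bullet> b (i mod d) else 0)"

definition dec :: "(nat \<Rightarrow> real) \<Rightarrow> nat \<Rightarrow> 'a" where
  "dec z = (\<lambda>k. \<Sum>l<d. z (k * d + l) *\<^sub>R b l)"

text \<open>The degree of \<open>f\<close> transported to the standard sphere of dimension
  \<open>r * d - 1\<close> and projected radially. It carries information when \<open>f\<close> has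
  no zero on \<open>block_sphere\<close>.\<close>

definition block_degree :: "((nat \<Rightarrow> 'a) \<Rightarrow> nat \<Rightarrow> 'a) \<Rightarrow> int" where
  "block_degree f = Brouwer_degree2 (r * d - 1) (\<lambda>z. normalise (r * d - 1) (enc (f (dec z))))"

lemma rd: "Suc (r * d - 1) = r * d"
  using r_pos d_pos by simp

lemma index_less: "\<lbrakk>k < r; l < d\<rbrakk> \<Longrightarrow> k * d + l < r * d"
proof -
  assume "k < r" "l < d"
  then have "k * d + l < Suc k * d" "Suc k * d \<le> r * d"
    by (simp, intro mult_le_mono1, simp)
  then show ?thesis by linarith
qed

lemma in_blk_expand: "v \<in> blk \<Longrightarrow> v = (\<Sum>l<d. (v \<bullet> b l) *\<^sub>R b l)"
proof (induction rule: span_induct_alt)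
  case base
  then show ?case by simp
next
  case (step c x y)
  then obtain i where i: "i < d" "x = b i" by auto
  have "(\<Sum>l<d. (x \<bullet> b l) *\<^sub>R b l) = (\<Sum>l<d. if l = i then b i else 0)"
    using i by (intro sum.cong) (auto simp: orthonormal)
  also have "\<dots> = x" using i by simp
  finally have x: "(\<Sum>l<d. (x \<bullet> b l) *\<^sub>R b l) = x" .
  have "(\<Sum>l<d. ((c *\<^sub>R x + y) \<bullet> b l) *\<^sub>R b l)
      = c *\<^sub>R (\<Sum>l<d. (x \<bullet> b l) *\<^sub>R b l) + (\<Sum>l<d. (y \<bullet> b l) *\<^sub>R b l)"
    by (simp add: inner_add_left scaleR_left_distrib sum.distrib scaleR_sum_right)
  then show ?case using x step.IH by simp
qed

lemma norm_dec: "(norm (dec z k))\<^sup>2 = (\<Sum>l<d. (z (k * d + l))\<^sup>2)"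
proof -
  have "(norm (dec z k))\<^sup>2 = (\<Sum>i<d. \<Sum>j<d. z (k * d + i) * z (k * d + j) * (b i \<bullet> b j))"
    unfolding power2_norm_eq_inner dec_def
    by (simp add: inner_sum_left inner_sum_right sum_distrib_left mult.assoc)
       (simp add: algebra_simps inner_commute)
  also have "\<dots> = (\<Sum>i<d. \<Sum>j<d. if i = j then (z (k * d + i))\<^sup>2 else 0)"
    by (intro sum.cong) (auto simp: orthonormal power2_eq_square)
  finally show ?thesis by simp
qed

lemma dec_in_blk: "dec z k \<in> blk"
  unfolding dec_def by (intro span_sum span_scale span_base) auto

lemma dec_inner: "l < d \<Longrightarrow> dec z k \<bullet> b l = z (k * d + l)"
proof -
  assume l: "l < d"
  have "dec z k \<bullet> b l = (\<Sum>j<d. if j = l then z (k * d + j) else 0)"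
    unfolding dec_def inner_sum_left using l by (intro sum.cong) (auto simp: orthonormal)
  then show ?thesis using l by simp
qed

lemma dec_block_sphere:
  assumes "z \<in> unit_nsphere (r * d - 1)"
  shows "dec z \<in> block_sphere"
proof -
  have "(\<Sum>k<r. (norm (dec z k))\<^sup>2) = (\<Sum>k<r. \<Sum>l<d. (z (k * d + l))\<^sup>2)"
    by (simp add: norm_dec)
  also have "\<dots> = (\<Sum>i<r*d. (z i)\<^sup>2)"
    using sum.nat_group[of "\<lambda>i. (z i)\<^sup>2" d r] 
    by (simp add: sum.shift_bounds_nat_ivl atLeast0LessThan sum.atLeastLessThan_shift_0 mult.commute add.commute)
  also have "\<dots> = (\<Sum>i\<le>r*d-1. (z i)\<^sup>2)"
    using rd by (metis lessThan_Suc_atMost)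
  also have "\<dots> = 1" using assms by (simp add: unit_nsphere_def)
  finally show ?thesis by (simp add: block_sphere_def dec_in_blk)
qed

lemma enc_dec:
  assumes "\<And>i. i \<ge> r * d \<Longrightarrow> z i = 0"
  shows "enc (dec z) = z"
  using assms d_pos by (auto simp: enc_def fun_eq_iff dec_inner)

lemma enc_nonzero:
  assumes "k < r" "w k \<in> blk" "w k \<noteq> 0"
  shows "\<exists>i\<le>r * d - 1. enc w i \<noteq> 0"
proof -
  have "\<exists>l<d. w k \<bullet> b l \<noteq> 0"
    using in_blk_expand[OF assms(2)] assms(3) by (metis (no_types, lifting) lessThan_iff scale_zero_left sum.neutral)
  then obtain l where l: "l < d" "w k \<bullet> b l \<noteq> 0" by blast
  then have "enc w (k * d + l) \<noteq> 0"
    using index_less[OF assms(1) l(1)] by (simp add: enc_def)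
  moreover have "k * d + l \<le> r * d - 1"
    using index_less[OF assms(1) l(1)] by simp
  ultimately show ?thesis by blast
qed

lemma continuous_dec: "continuous_on UNIV dec"
  unfolding dec_def
  by (intro continuous_intros continuous_on_coordinatewise_then_product
      continuous_on_product_coordinates)

lemma continuous_enc: "continuous_on UNIV enc"
  unfolding enc_def
proof (intro continuous_on_coordinatewise_then_product)
  fix i
  show "continuous_on UNIV (\<lambda>w::nat \<Rightarrow> 'a. if i < r * d then w (i div d) \<bullet> b (i mod d) else 0)"
    by (cases "i < r * d") (auto intro!: continuous_intros)
qed

text \<open>The tool for every comparison of degrees below. Since \<open>enc\<close> reads only the
  first \<open>r\<close> entries, membership in \<open>blk\<close> and nonvanishing are asked for
  these entries alone.\<close>

lemma block_degree_homotopy: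
  fixes K :: "real \<times> (nat \<Rightarrow> 'a) \<Rightarrow> nat \<Rightarrow> 'a"
  assumes cont: "continuous_on ({0..1} \<times> block_sphere) K"
    and blk: "\<And>t w k. \<lbrakk>t \<in> {0..1}; w \<in> block_sphere; k < r\<rbrakk> \<Longrightarrow> K (t, w) k \<in> blk"
    and nz: "\<And>t w. \<lbrakk>t \<in> {0..1}; w \<in> block_sphere; \<And>k. k < r \<Longrightarrow> K (t, w) k = 0\<rbrakk> \<Longrightarrow> False"
  shows "block_degree (\<lambda>w. K (0, w)) = block_degree (\<lambda>w. K (1, w))"
proof -
  let ?H = "\<lambda>(t, z). enc (K (t, dec z))"
  have 1: "continuous_on ({0..1} \<times> unit_nsphere (r * d - 1)) ((\<lambda>x. enc x) \<circ> (K \<circ> (\<lambda>x. (fst x, dec (snd x)))))"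
  proof (intro continuous_on_compose)
    show "continuous_on ({0..1} \<times> unit_nsphere (r * d - 1)) (\<lambda>x. (fst x, dec (snd x)))"
      by (rule continuous_on_Pair[OF _ continuous_on_compose2[OF continuous_dec]]) (auto intro: continuous_intros)
    show "continuous_on ((\<lambda>x. (fst x, dec (snd x))) ` ({0..1} \<times> unit_nsphere (r * d - 1))) K"
      by (rule continuous_on_subset[OF cont]) (use dec_block_sphere in auto)
    show "continuous_on ((K \<circ> (\<lambda>x. (fst x, dec (snd x)))) ` ({0..1} \<times> unit_nsphere (r * d - 1))) enc"
      using continuous_enc continuous_on_subset by blast
  qed
  have "continuous_on ({0..1} \<times> unit_nsphere (r * d - 1)) ?H"
    using 1 by (simp add: o_def case_prod_unfold)
  then have "Brouwer_degree2 (r * d - 1) (\<lambda>x. normalise (r * d - 1) (?H (0, x)))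
      = Brouwer_degree2 (r * d - 1) (\<lambda>x. normalise (r * d - 1) (?H (1, x)))"
  proof (rule Brouwer_degree2_normalise_homotopy)
    fix t :: real and x
    assume t: "t \<in> {0..1}" and x: "x \<in> unit_nsphere (r * d - 1)"
    then obtain k where "k < r" "K (t, dec x) k \<noteq> 0"
      using nz dec_block_sphere by blast
    then show "\<exists>i\<le>r * d - 1. ?H (t, x) i \<noteq> 0"
      using enc_nonzero blk t dec_block_sphere[OF x] by simp
  qed
  then show ?thesis by (simp add: block_degree_def)
qed

lemma block_degree_id: "block_degree (\<lambda>w. w) = 1"
proof -
  have "block_degree (\<lambda>w. w) = Brouwer_degree2 (r * d - 1) id"
    unfolding block_degree_def
  proof (rule Brouwer_degree2_eq)
    fix x assume "x \<in> topspace (nsphere (r * d - 1))"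
    then have x: "x \<in> unit_nsphere (r * d - 1)" by (simp add: nsphere_eq_top_of_set)
    then have "enc (dec x) = x"
      using rd by (intro enc_dec) (auto simp: unit_nsphere_def)
    then show "normalise (r * d - 1) (enc (dec x)) = id x"
      using normalise_eq_self[OF x] by simp
  qed
  then show ?thesis by simp
qed

text \<open>Block 0 occupies the coordinates below \<open>d\<close>, so the map is a product of
  \<open>d\<close> coordinate reflections.\<close>

lemma block_degree_uminus_first: "block_degree (\<lambda>w. w(0 := - w 0)) = (- 1) ^ d"
proof -
  let ?R = "\<lambda>x i. if i < d then - x i else x i :: real"
  have "block_degree (\<lambda>w. w(0 := - w 0)) = Brouwer_degree2 (r * d - 1) ?R"
    unfolding block_degree_def
  proof (rule Brouwer_degree2_eq)
    fix x assume "x \<in> topspace (nsphere (r * d - 1))"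
    then have x: "x \<in> unit_nsphere (r * d - 1)" by (simp add: nsphere_eq_top_of_set)
    then have x0: "x i = 0" if "i \<ge> r * d" for i
      using that rd x by (auto simp: unit_nsphere_def)
    have drd: "d \<le> r * d" using r_pos by simp
    have "enc ((dec x)(0 := - dec x 0)) i = ?R x i" for i
    proof (cases "i < r * d")
      case True
      then show ?thesis
        using d_pos by (auto simp: enc_def dec_inner div_eq_0_iff)
    next
      case False
      then show ?thesis using x0 drd by (auto simp: enc_def)
    qed
    then have "enc ((dec x)(0 := - dec x 0)) = ?R x" by blast
    moreover have "?R x \<in> unit_nsphere (r * d - 1)"
    proof -
      have "(\<Sum>i\<le>r*d-1. (?R x i)\<^sup>2) = (\<Sum>i\<le>r*d-1. (x i)\<^sup>2)"
        by (intro sum.cong) auto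
      then show ?thesis using x r_pos d_pos by (auto simp: unit_nsphere_def)
    qed
    ultimately show "normalise (r * d - 1) (enc ((dec x)(0 := - dec x 0))) = ?R x"
      using normalise_eq_self by metis
  qed
  also have "\<dots> = (- 1) ^ d"
    by (rule Brouwer_degree2_reflect_initial) (use r_pos rd in simp)
  finally show ?thesis .
qed

text \<open>The exchange of two entries and the negation of one entry are both reflections in the
  plane of these two entries, and a rotation of the axis joins them.\<close>

lemma block_degree_swap:
  assumes "r \<ge> 2"
  shows "block_degree (\<lambda>w. w(0 := w 1, 1 := w 0)) = (- 1) ^ d"
proof -
  \<comment> \<open>On the entries 0 and 1 this is the matrix with rows (-cos, sin) and (sin, cos),
    a reflection at every time: it negates entry 0 at time 0 and exchanges the two entries at time
    1.\<close>
  define K :: "real \<times> (nat \<Rightarrow> 'a) \<Rightarrow> nat \<Rightarrow> 'a" where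
    "K = (\<lambda>(t, w). w(0 := sin (t * (pi/2)) *\<^sub>R w 1 - cos (t * (pi/2)) *\<^sub>R w 0,
                     1 := cos (t * (pi/2)) *\<^sub>R w 1 + sin (t * (pi/2)) *\<^sub>R w 0))"
  have coord: "continuous_on A (\<lambda>x. snd x k)" for A :: "(real \<times> (nat \<Rightarrow> 'a)) set" and k
    by (rule continuous_on_product_then_coordinatewise) (intro continuous_intros)
  have "block_degree (\<lambda>w. K (0, w)) = block_degree (\<lambda>w. K (1, w))"
  proof (rule block_degree_homotopy)
    show "continuous_on ({0..1} \<times> block_sphere) K"
      unfolding K_def case_prod_unfold
    proof (intro continuous_on_coordinatewise_then_product)
      fix i :: nat
      consider "i = 0" | "i = 1" | "i \<noteq> 0" "i \<noteq> 1" by blast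
      then show "continuous_on ({0..1} \<times> block_sphere)
         (\<lambda>x. ((snd x)(0 := sin (fst x * (pi/2)) *\<^sub>R snd x 1 - cos (fst x * (pi/2)) *\<^sub>R snd x 0,
            1 := cos (fst x * (pi/2)) *\<^sub>R snd x 1 + sin (fst x * (pi/2)) *\<^sub>R snd x 0)) i)"
        by cases (auto intro!: continuous_intros coord)
    qed
  next
    fix t :: real and w k
    assume "w \<in> block_sphere" "k < r"
    then show "K (t, w) k \<in> blk"
      using assms by (auto simp: K_def block_sphere_def intro!: span_add span_diff span_scale)
  next
    fix t :: real and w
    assume w: "w \<in> block_sphere" and z: "\<And>k. k < r \<Longrightarrow> K (t, w) k = 0"
    let ?s = "sin (t * (pi/2))" and ?c = "cos (t * (pi/2))"
    have e0: "?s *\<^sub>R w 1 - ?c *\<^sub>R w 0 = 0" and e1: "?c *\<^sub>R w 1 + ?s *\<^sub>R w 0 = 0"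
      using z[of 0] z[of 1] assms by (auto simp: K_def)
    have sc: "?s * ?s + ?c * ?c = 1"
      using sin_cos_squared_add[of "t * (pi/2)"] by (simp only: power2_eq_square)
    \<comment> \<open>The matrix is its own inverse up to the factor \<open>s * s + c * c\<close>;
      applying it again recovers \<open>w 0\<close> and \<open>w 1\<close> from the two vanishing
      entries.\<close>
    have eqs: "(s * s + c * c) *\<^sub>R w 1 = s *\<^sub>R (s *\<^sub>R w 1 - c *\<^sub>R w 0) + c *\<^sub>R (c *\<^sub>R w 1 + s *\<^sub>R w 0)"
      "(s * s + c * c) *\<^sub>R w 0 = s *\<^sub>R (c *\<^sub>R w 1 + s *\<^sub>R w 0) - c *\<^sub>R (s *\<^sub>R w 1 - c *\<^sub>R w 0)" for s c :: real
      by (simp_all add: algebra_simps)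
    have "w 1 = 0"
      using eqs(1)[of ?s ?c] by (simp only: sc e0 e1 scaleR_zero_right scaleR_one add_0)
    moreover have "w 0 = 0"
      using eqs(2)[of ?s ?c] by (simp only: sc e0 e1 scaleR_zero_right scaleR_one diff_zero)
    moreover have "w k = 0" if "k < r" "k \<noteq> 0" "k \<noteq> 1" for k
      using z[OF that(1)] that by (simp add: K_def)
    ultimately have "w k = 0" if "k < r" for k
      using that by (cases "k = 0 \<or> k = 1") auto
    then show False using w by (simp add: block_sphere_def)
  qed
  moreover have "(\<lambda>w. K (0, w)) = (\<lambda>w. w(0 := - w 0))" "(\<lambda>w. K (1, w)) = (\<lambda>w. w(0 := w 1, 1 := w 0))"
    by (auto simp: K_def fun_eq_iff)
  ultimately show ?thesis using block_degree_uminus_first by simp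
qed

end


section \<open>Open covers with homotopic projections\<close>

text \<open>A point is assigned to those \<open>A i\<close> for which its distance to the complement
  of \<open>V i\<close> is largest. The largest distance is positive because the \<open>V i\<close>
  cover, so such a point lies in \<open>V i\<close>.\<close>

lemma closed_shrinking:
  fixes X :: "'a::metric_space set"
  assumes fin: "finite I" and ope: "\<And>i. i \<in> I \<Longrightarrow> openin (top_of_set X) (V i)"
    and cov: "X \<subseteq> (\<Union>i\<in>I. V i)"
  obtains A where "\<And>i. i \<in> I \<Longrightarrow> closedin (top_of_set X) (A i)"
    "\<And>i. i \<in> I \<Longrightarrow> A i \<subseteq> V i" "X \<subseteq> (\<Union>i\<in>I. A i)"
\<comment> \<open>The value of \<open>infdist\<close> at an empty set is 0, so a member
  \<open>V i\<close> that contains all of \<open>X\<close> has to be treated separately.\<close>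
proof (cases "\<exists>i\<in>I. X \<subseteq> V i")
  case True
  then obtain i where "i \<in> I" "X \<subseteq> V i" by blast
  then show thesis
    by (intro that[of "\<lambda>j. if j = i then X else {}"]) auto
next
  case False
  define f where "f i x = infdist x (X - V i)" for i x
  have pos: "f i x > 0" if i: "i \<in> I" and x: "x \<in> V i" for i x
  proof -
    obtain T where T: "open T" "V i = X \<inter> T"
      using ope[OF i] by (auto simp: openin_open)
    have "x \<notin> closure (X - V i)"
    proof
      assume "x \<in> closure (X - V i)"
      moreover have "closure (X - V i) \<subseteq> - T"
        by (rule closure_minimal) (use T in auto)
      ultimately show False using x T by auto
    qed
    moreover have "X - V i \<noteq> {}" using False i by auto
    ultimately show ?thesis
      using in_closure_iff_infdist_zero[of "X - V i" x] infdist_nonneg[of x "X - V i"]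
      by (simp add: f_def order_less_le)
  qed
  have zero: "f i x = 0" if "x \<in> X" "x \<notin> V i" for i x
    using that by (simp add: f_def)
  define A where "A i = {x \<in> X. \<forall>j\<in>I. f j x \<le> f i x}" for i
  have max: "\<exists>i\<in>I. x \<in> A i" if "x \<in> X" for x
  proof -
    have "I \<noteq> {}" using cov that by auto
    then obtain i where "i \<in> I" "\<And>j. j \<in> I \<Longrightarrow> f j x \<le> f i x"
      using obtains_MAX[OF fin, of "\<lambda>i. f i x"] by (metis Max_ge fin finite_imageI imageI)
    then show ?thesis using that by (auto simp: A_def)
  qed
  show thesis
  proof (rule that[of A])
    fix i assume i: "i \<in> I"
    have "closed (\<Inter>j\<in>I. {x. f j x \<le> f i x})"
      by (intro closed_INT ballI closed_Collect_le) (auto simp: f_def intro!: continuous_intros)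
    moreover have "A i = X \<inter> (\<Inter>j\<in>I. {x. f j x \<le> f i x})"
      by (auto simp: A_def)
    ultimately show "closedin (top_of_set X) (A i)"
      by (auto simp: closedin_closed)
    show "A i \<subseteq> V i"
    proof
      fix x assume x: "x \<in> A i"
      then have "x \<in> X" by (simp add: A_def)
      then obtain j where "j \<in> I" "x \<in> V j" using cov by blast
      then have "0 < f i x" using x pos[of j x] by (auto simp: A_def intro: less_le_trans)
      then show "x \<in> V i" using zero \<open>x \<in> X\<close> by force
    qed
  next
    show "X \<subseteq> (\<Union>i\<in>I. A i)" using max by blast
  qed
qed

text \<open>The radial retraction onto the closed unit ball. It is the identity on the ball and the
  direction \<open>sgn\<close> outside, so it is a continuous map that fits onto homotopies starting
  at \<open>sgn\<close>.\<close>

definition clip :: "'a::real_normed_vector \<Rightarrow> 'a" where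
  "clip v = v /\<^sub>R max 1 (norm v)"

lemma clip_eq_0_iff [simp]: "clip v = 0 \<longleftrightarrow> v = 0"
  by (auto simp: clip_def max_def)

lemma clip_eq_self: "norm v \<le> 1 \<Longrightarrow> clip v = v"
  by (simp add: clip_def max_def)

lemma clip_eq_sgn: "norm v \<ge> 1 \<Longrightarrow> clip v = sgn v"
  by (auto simp: clip_def sgn_div_norm max_def)

lemma continuous_on_clip [continuous_intros]:
  "continuous_on S f \<Longrightarrow> continuous_on S (\<lambda>x. clip (f x))"
  unfolding clip_def by (intro continuous_intros) auto

section \<open>Extension of the homotopies to W^r and the contradiction of degrees\<close>

context orthonormal_blocks
begin

text \<open>The norm of \<open>w k\<close> between 1 and 2 serves as the time of the homotopy
  \<open>G\<close>. The values are prescribed on three closed sets and extended from there; in the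
  band outside \<open>A\<close> nothing but membership in \<open>blk\<close> is known about
  \<open>f\<close>.\<close>

lemma homotopy_extension:
  fixes G :: "(nat \<Rightarrow> 'a) \<times> real \<Rightarrow> 'a"
  assumes A: "closed A" "A \<subseteq> {w. w k \<in> blk \<and> w j \<in> blk \<and> 1 \<le> norm (w j)}"
    and G: "continuous_on (A \<times> {0..1}) G"
    and G_in: "\<And>w t. \<lbrakk>w \<in> A; t \<in> {0..1}\<rbrakk> \<Longrightarrow> G (w, t) \<in> blk"
    and G_0: "\<And>w. w \<in> A \<Longrightarrow> G (w, 0) = sgn (w j)"
    and G_1: "\<And>w. w \<in> A \<Longrightarrow> G (w, 1) = sgn (w k)"
  obtains f :: "(nat \<Rightarrow> 'a) \<Rightarrow> 'a" where "continuous_on UNIV f" "\<And>w. f w \<in> blk"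
    "\<And>w. \<lbrakk>w k \<in> blk; w j \<in> blk; norm (w k) \<le> 1\<rbrakk> \<Longrightarrow> f w = clip (w j)"
    "\<And>w. \<lbrakk>w k \<in> blk; w j \<in> blk; norm (w k) \<ge> 2\<rbrakk> \<Longrightarrow> f w = sgn (w k)"
    "\<And>w. \<lbrakk>w \<in> A; 1 \<le> norm (w k); norm (w k) \<le> 2\<rbrakk> \<Longrightarrow> f w = G (w, norm (w k) - 1)"
proof -
  define D where "D = {w. w k \<in> blk \<and> w j \<in> blk}"
  have coord: "continuous_on S (\<lambda>w::nat \<Rightarrow> 'a. w i)" for S i
    by (rule continuous_on_product_then_coordinatewise) (intro continuous_intros)
  have clblk: "closed {w::nat \<Rightarrow> 'a. w i \<in> blk}" for i
    using closed_vimage[of blk "\<lambda>w::nat \<Rightarrow> 'a. w i"] closed_subspace[OF subspace_span] coord by (simp add: vimage_def)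
  have D: "closed D"
    unfolding D_def by (intro closed_Collect_conj clblk)
  define P1 where "P1 = D \<inter> {w. norm (w k) \<le> 1}"
  define P2 where "P2 = D \<inter> {w. 2 \<le> norm (w k)}"
  define P3 where "P3 = A \<inter> {w. 1 \<le> norm (w k)} \<inter> {w. norm (w k) \<le> 2}"
  have cl: "closed P1" "closed P2" "closed P3"
    unfolding P1_def P2_def P3_def
    by (intro closed_Int D A closed_Collect_le continuous_intros coord)+
  let ?g = "\<lambda>w. if norm (w k) \<ge> 2 then sgn (w k) else G (w, norm (w k) - 1)"
  let ?f = "\<lambda>w. if norm (w k) \<le> 1 then clip (w j) else ?g w"
  have c3: "continuous_on P3 (\<lambda>w. G (w, norm (w k) - 1))"
    by (rule continuous_on_compose2[OF G]) (auto simp: P3_def intro!: continuous_intros coord)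
  have c2: "continuous_on P2 (\<lambda>w. sgn (w k))"
    by (intro continuous_on_sgn coord) (auto simp: P2_def)
  \<comment> \<open>\<open>P2\<close> and \<open>P3\<close> meet where the norm of
    \<open>w k\<close> is 2, that is, at time 1 of \<open>G\<close>.\<close>
  have agree2: "\<forall>x. x \<in> P2 \<and> \<not> 2 \<le> norm (x k) \<or> x \<in> P3 \<and> 2 \<le> norm (x k) \<longrightarrow>
        sgn (x k) = G (x, norm (x k) - 1)"
  proof (intro allI impI)
    fix x assume "x \<in> P2 \<and> \<not> 2 \<le> norm (x k) \<or> x \<in> P3 \<and> 2 \<le> norm (x k)"
    then have "x \<in> A" "norm (x k) - 1 = 1" by (auto simp: P2_def P3_def)
    then show "sgn (x k) = G (x, norm (x k) - 1)" using G_1 by simp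
  qed
  have c1: "continuous_on P1 (\<lambda>w. clip (w j))"
    by (intro continuous_intros coord)
  \<comment> \<open>\<open>P1\<close> and \<open>P3\<close> meet at time 0 of \<open>G\<close>.
    There \<open>clip (w j)\<close> is \<open>sgn (w j)\<close>, because on \<open>A\<close> the
    norm of \<open>w j\<close> is at least 1.\<close>
  have agree1: "\<forall>x. x \<in> P1 \<and> \<not> norm (x k) \<le> 1 \<or> x \<in> P2 \<union> P3 \<and> norm (x k) \<le> 1 \<longrightarrow> clip (x j) = ?g x"
  proof (intro allI impI)
    fix x assume "x \<in> P1 \<and> \<not> norm (x k) \<le> 1 \<or> x \<in> P2 \<union> P3 \<and> norm (x k) \<le> 1"
    then have x: "x \<in> A" "norm (x k) = 1" by (auto simp: P1_def P2_def P3_def)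
    then have "clip (x j) = sgn (x j)" using A(2) by (intro clip_eq_sgn) auto
    then show "clip (x j) = ?g x" using x G_0 by simp
  qed
  have "continuous_on (P1 \<union> (P2 \<union> P3)) ?f"
    by (rule continuous_on_cases[OF cl(1) closed_Un[OF cl(2,3)] c1
          continuous_on_cases[OF cl(2,3) c2 c3 agree2] agree1])
  moreover have "?f ` (P1 \<union> (P2 \<union> P3)) \<subseteq> blk"
    using G_in A(2) by (auto simp: P1_def P2_def P3_def D_def clip_def sgn_div_norm subset_iff intro!: span_scale)
  moreover have "closedin (top_of_set UNIV) (P1 \<union> (P2 \<union> P3))"
    using cl by auto
  \<comment> \<open>Dugundji's theorem extends a map from a closed set with values in a convex set,
    here the subspace \<open>blk\<close>.\<close>
  ultimately obtain f where f: "continuous_on UNIV f" "f ` UNIV \<subseteq> blk"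
    "\<And>w. w \<in> P1 \<union> (P2 \<union> P3) \<Longrightarrow> f w = ?f w"
    using Dugundji[of blk UNIV "P1 \<union> (P2 \<union> P3)" ?f] subspace_imp_convex[OF subspace_span]
    by (metis (no_types, lifting) empty_iff span_zero)
  show thesis
  proof (rule that[OF f(1)])
    show "f w \<in> blk" for w using f(2) by blast
    fix w :: "nat \<Rightarrow> 'a"
    show "f w = clip (w j)" if "w k \<in> blk" "w j \<in> blk" "norm (w k) \<le> 1"
      using f(3)[of w] that by (simp add: P1_def D_def)
    show "f w = sgn (w k)" if "w k \<in> blk" "w j \<in> blk" "norm (w k) \<ge> 2"
      using f(3)[of w] that by (simp add: P2_def D_def)
    show "f w = G (w, norm (w k) - 1)" if w: "w \<in> A" "1 \<le> norm (w k)" "norm (w k) \<le> 2"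
    proof -
      have "f w = ?f w" using f(3)[of w] w by (simp add: P3_def)
      moreover have "clip (w j) = sgn (w j)" using A(2) w by (intro clip_eq_sgn) auto
      ultimately show ?thesis
        using w G_0[OF w(1)] G_1[OF w(1)] by (cases "norm (w k) = 1"; cases "norm (w k) = 2") auto
    qed
  qed
qed

text \<open>On \<open>V k\<close> the homotopy \<open>G k\<close> joins the projections to the
  entries \<sigma> k and k. The resulting maps are assembled into \<open>h\<close>, which vanishes
  only at the origin, has degree 1 on a small sphere and the degree of the exchange on a large
  one.\<close>

lemma homotopic_projections_cover_False:
  fixes G :: "nat \<Rightarrow> (nat \<Rightarrow> 'a) \<times> real \<Rightarrow> 'a"
  defines "\<Omega> \<equiv> {w. \<forall>k<r. w k \<in> blk \<and> 1 \<le> norm (w k)}"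
    and "\<sigma> \<equiv> \<lambda>k::nat. if k = 0 then 1 else 0"
  assumes r2: "r \<ge> 2" and odd: "odd d"
    and V: "\<And>k. k < r \<Longrightarrow> openin (top_of_set \<Omega>) (V k)" and cov: "\<Omega> \<subseteq> (\<Union>k<r. V k)"
    and G: "\<And>k. k < r \<Longrightarrow> continuous_on (V k \<times> {0..1}) (G k)"
    and G_in: "\<And>k w t. \<lbrakk>k < r; w \<in> V k; t \<in> {0..1}\<rbrakk> \<Longrightarrow> G k (w, t) \<in> blk - {0}"
    and G_0: "\<And>k w. \<lbrakk>k < r; w \<in> V k\<rbrakk> \<Longrightarrow> G k (w, 0) = sgn (w (\<sigma> k))"
    and G_1: "\<And>k w. \<lbrakk>k < r; w \<in> V k\<rbrakk> \<Longrightarrow> G k (w, 1) = sgn (w k)"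
  shows False
proof -
  have coord: "continuous_on S (\<lambda>w::nat \<Rightarrow> 'a. w i)" for S i
    by (rule continuous_on_product_then_coordinatewise) (intro continuous_intros)
  have clblk: "closed {w::nat \<Rightarrow> 'a. w i \<in> blk}" for i
    using closed_vimage[of blk "\<lambda>w::nat \<Rightarrow> 'a. w i"] closed_subspace[OF subspace_span] coord
    by (simp add: vimage_def)
  have "\<Omega> = (\<Inter>k<r. {w. w k \<in> blk} \<inter> {w. 1 \<le> norm (w k)})"
    by (auto simp: \<Omega>_def)
  moreover have "closed (\<Inter>k<r. {w::nat \<Rightarrow> 'a. w k \<in> blk} \<inter> {w. 1 \<le> norm (w k)})"
    by (intro closed_INT ballI closed_Int clblk closed_Collect_le continuous_intros coord)
  ultimately have "closed \<Omega>" by simp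
  \<comment> \<open>The extension lemma starts from closed sets, so the open cover is first shrunk
    to a closed one.\<close>
  obtain A where A: "\<And>k. k < r \<Longrightarrow> closedin (top_of_set \<Omega>) (A k)"
    "\<And>k. k < r \<Longrightarrow> A k \<subseteq> V k" "\<Omega> \<subseteq> (\<Union>k<r. A k)"
    using closed_shrinking[of "{..<r}" \<Omega> V] V cov by (metis finite_lessThan lessThan_iff)
  have A\<Omega>: "A k \<subseteq> \<Omega>" if "k < r" for k
    using A(1)[OF that] by (simp add: closedin_imp_subset)
  \<comment> \<open>The last clause records that \<open>G k\<close> avoids zero. This is all that
    remains of the homotopies from here on.\<close>
  define Q where "Q k f \<longleftrightarrow> continuous_on UNIV f \<and> (\<forall>w. f w \<in> blk) \<and>
      (\<forall>w. w k \<in> blk \<and> w (\<sigma> k) \<in> blk \<and> norm (w k) \<le> 1 \<longrightarrow> f w = clip (w (\<sigma> k))) \<and>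
      (\<forall>w. w k \<in> blk \<and> w (\<sigma> k) \<in> blk \<and> norm (w k) \<ge> 2 \<longrightarrow> f w = sgn (w k)) \<and>
      (\<forall>w\<in>A k. 1 \<le> norm (w k) \<and> norm (w k) \<le> 2 \<longrightarrow> f w \<noteq> 0)" for k and f :: "(nat \<Rightarrow> 'a) \<Rightarrow> 'a"
  have "\<exists>f. Q k f" if k: "k < r" for k
  proof (rule homotopy_extension[of "A k" k "\<sigma> k" "G k"])
    show "closed (A k)"
      using A(1)[OF k] \<open>closed \<Omega>\<close> by (rule closedin_closed_trans)
    show "A k \<subseteq> {w. w k \<in> blk \<and> w (\<sigma> k) \<in> blk \<and> 1 \<le> norm (w (\<sigma> k))}"
      using A\<Omega>[OF k] k r2 by (auto simp: \<Omega>_def \<sigma>_def)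
    show "continuous_on (A k \<times> {0..1}) (G k)"
      by (rule continuous_on_subset[OF G[OF k]]) (use A(2)[OF k] in auto)
    show "G k (w, t) \<in> blk" if "w \<in> A k" "t \<in> {0..1}" for w t
      using G_in[OF k _ that(2)] A(2)[OF k] that(1) by blast
    show "G k (w, 0) = sgn (w (\<sigma> k))" if "w \<in> A k" for w
      using G_0[OF k] A(2)[OF k] that by blast
    show "G k (w, 1) = sgn (w k)" if "w \<in> A k" for w
      using G_1[OF k] A(2)[OF k] that by blast
  next
    fix f :: "(nat \<Rightarrow> 'a) \<Rightarrow> 'a"
    assume f: "continuous_on UNIV f" "\<And>w. f w \<in> blk"
      "\<And>w. \<lbrakk>w k \<in> blk; w (\<sigma> k) \<in> blk; norm (w k) \<le> 1\<rbrakk> \<Longrightarrow> f w = clip (w (\<sigma> k))"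
      "\<And>w. \<lbrakk>w k \<in> blk; w (\<sigma> k) \<in> blk; norm (w k) \<ge> 2\<rbrakk> \<Longrightarrow> f w = sgn (w k)"
      "\<And>w. \<lbrakk>w \<in> A k; 1 \<le> norm (w k); norm (w k) \<le> 2\<rbrakk> \<Longrightarrow> f w = G k (w, norm (w k) - 1)"
    have "f w \<noteq> 0" if w: "w \<in> A k" "1 \<le> norm (w k)" "norm (w k) \<le> 2" for w
    proof -
      have "w \<in> V k" using w A(2)[OF k] by blast
      then show ?thesis using f(5)[OF w] G_in[OF k, of w "norm (w k) - 1"] w by auto
    qed
    then have "Q k f" unfolding Q_def using f by blast
    then show ?thesis by (rule exI[of "Q k" f])
  qed
  then obtain f where Q: "\<And>k. k < r \<Longrightarrow> Q k (f k)" by metis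
  have f: "\<And>k. k < r \<Longrightarrow> continuous_on UNIV (f k)" "\<And>k w. k < r \<Longrightarrow> f k w \<in> blk"
    and f_small: "\<And>k w. \<lbrakk>k < r; w k \<in> blk; w (\<sigma> k) \<in> blk; norm (w k) \<le> 1\<rbrakk> \<Longrightarrow> f k w = clip (w (\<sigma> k))"
    and f_large: "\<And>k w. \<lbrakk>k < r; w k \<in> blk; w (\<sigma> k) \<in> blk; norm (w k) \<ge> 2\<rbrakk> \<Longrightarrow> f k w = sgn (w k)"
    and f_nz: "\<And>k w. \<lbrakk>k < r; w \<in> A k; 1 \<le> norm (w k); norm (w k) \<le> 2\<rbrakk> \<Longrightarrow> f k w \<noteq> 0"
    using Q unfolding Q_def by blast+
  have r01: "0 < r" "Suc 0 < r" using r2 by auto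
  \<comment> \<open>For small entries \<open>f 1\<close> gives \<open>w 0\<close> and
    \<open>f 0\<close> gives \<open>w 1\<close>, hence the exchanged positions in \<open>h\<close>.
    For \<open>k\<close> at least 2, however, \<open>f k\<close> gives \<open>w 0\<close> there, and
    the weight \<mu> brings \<open>w k\<close> back as \<open>w 0\<close> tends to 0.\<close>
  define \<mu> where "\<mu> w = min 1 (norm (w 0))" for w :: "nat \<Rightarrow> 'a"
  define h where "h w k = (if k = 0 then f 1 w else if k = 1 then f 0 w
      else if k < r then \<mu> w *\<^sub>R f k w + (1 - \<mu> w) *\<^sub>R w k else 0)" for w k
  have h01: "h w 0 = f 1 w" "h w (Suc 0) = f 0 w" for w
    by (auto simp: h_def)
  have hk: "h w k = \<mu> w *\<^sub>R f k w + (1 - \<mu> w) *\<^sub>R w k" if "k < r" "k \<ge> 2" for w k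
    using that by (simp add: h_def)
  have h_cont: "continuous_on S h" for S
  proof (intro continuous_on_coordinatewise_then_product)
    fix k
    have fc: "continuous_on S (f k)" if "k < r" for k
      using f(1)[OF that] continuous_on_subset by blast
    consider "k = 0" | "k = 1" | "k \<ge> 2" "k < r" | "k \<ge> 2" "\<not> k < r" by linarith
    then show "continuous_on S (\<lambda>w. h w k)"
    proof cases
      case 3
      have "continuous_on S (\<lambda>w. \<mu> w *\<^sub>R f k w + (1 - \<mu> w) *\<^sub>R w k)"
        unfolding \<mu>_def using 3 by (intro continuous_intros coord fc)
      then show ?thesis by (simp only: hk[OF 3(2,1)])
    qed (use r01 in \<open>auto simp: h_def intro!: fc\<close>)
  qed
  have wc: "continuous_on T (\<lambda>x. snd x k)" for T :: "(real \<times> (nat \<Rightarrow> 'a)) set" and k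
    by (rule continuous_on_product_then_coordinatewise[OF continuous_on_snd[OF continuous_on_id]])
  have hc: "continuous_on T (\<lambda>x. h (g x))" if "continuous_on T g" for T :: "(real \<times> (nat \<Rightarrow> 'a)) set" and g
    by (rule continuous_on_compose2[OF h_cont[of UNIV] that]) simp
  have h_blk: "h w k \<in> blk" if "k < r" "w k \<in> blk" for w k
    using that r01 by (auto simp: h_def f intro!: span_add span_scale)
  have h_zero: "w k = 0" if w: "\<And>k. k < r \<Longrightarrow> w k \<in> blk" and z: "\<And>k. k < r \<Longrightarrow> h w k = 0" and "k < r" for w k
  proof -
    have small: "f k w = clip (w (\<sigma> k))" if "k < r" "norm (w k) \<le> 1" for k
      using that w r01 by (intro f_small) (auto simp: \<sigma>_def)
    have large: "f k w = sgn (w k)" if "k < r" "norm (w k) \<ge> 2" for k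
      using that w r01 by (intro f_large) (auto simp: \<sigma>_def)
    have f0: "f 0 w = 0" and f1: "f (Suc 0) w = 0"
      using z[of 0] z[of "Suc 0"] r01 by (auto simp: h01)
    show ?thesis
    \<comment> \<open>If \<open>w 0\<close> is shorter than 1, then \<open>f 0\<close> is the
      clipped \<open>w 1\<close>, so \<open>w 1\<close> is zero; then \<open>f 1\<close> is the
      clipped \<open>w 0\<close>, so \<open>w 0\<close> is zero too. Now \<mu> is 0 and the other
      entries of \<open>h\<close> are those of \<open>w\<close>.\<close>
    proof (cases "norm (w 0) < 1")
      case True
      then have w1: "w (Suc 0) = 0" using small[of 0] f0 r01 by (simp add: \<sigma>_def)
      then have w0: "w 0 = 0" using small[of "Suc 0"] f1 r01 by (simp add: \<sigma>_def)
      show ?thesis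
      proof (cases "k \<ge> 2")
        case True
        then show ?thesis using hk[of k w] z[of k] \<open>k < r\<close> w0 by (simp add: \<mu>_def)
      next
        case False
        then have "k = 0 \<or> k = Suc 0" by linarith
        then show ?thesis using w0 w1 by blast
      qed
    next
      case False
      then have w0: "w 0 \<noteq> 0" "1 \<le> norm (w 0)" "\<mu> w = 1" by (auto simp: \<mu>_def)
      \<comment> \<open>Here \<mu> is 1, so all the \<open>f k\<close> vanish together. This forces
        every norm into [1,2], where the cover by the sets \<open>A k\<close> provides some
        \<open>f k\<close> that does not vanish.\<close>
      have fz: "f k w = 0" if "k < r" for k
      proof -
        consider "k = 0" | "k = Suc 0" | "k \<ge> 2" by linarith
        then show ?thesis
          by cases (use f0 f1 hk[of k w] z[of k] w0 that in auto)
      qed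
      have gt1: "norm (w k) \<ge> 1" if "k < r" for k
      proof (rule ccontr)
        assume "\<not> 1 \<le> norm (w k)"
        then show False using small[OF that] fz[OF that] w0 by (cases "k = 0") (auto simp: \<sigma>_def)
      qed
      have lt2: "norm (w k) \<le> 2" if "k < r" for k
      proof (rule ccontr)
        assume "\<not> norm (w k) \<le> 2"
        then show False using large[OF that] fz[OF that] by (auto simp: sgn_zero_iff)
      qed
      have "w \<in> \<Omega>" using w gt1 by (simp add: \<Omega>_def)
      then obtain k' where "k' < r" "w \<in> A k'" using A(3) by blast
      then show ?thesis using f_nz[of k' w] gt1 lt2 fz by blast
    qed
  qed
  have sphere_norm: "norm (w k) \<le> 1" if "w \<in> block_sphere" "k < r" for w k
  proof -
    have "(norm (w k))\<^sup>2 \<le> (\<Sum>k<r. (norm (w k))\<^sup>2)"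
      by (rule member_le_sum) (use that in auto)
    then have "(norm (w k))\<^sup>2 \<le> 1" using that by (simp add: block_sphere_def)
    then show ?thesis by (rule power2_le_imp_le[of _ 1, simplified])
  qed
  have sphere_blk: "w k \<in> blk" if "w \<in> block_sphere" "k < r" for w k
    using that by (simp add: block_sphere_def)
  have sphere_nz: False if "w \<in> block_sphere" "\<And>k. k < r \<Longrightarrow> w k = 0" for w
    using that by (simp add: block_sphere_def)
  have near: "block_degree (\<lambda>w. w) = block_degree h"
  proof -
    define K where "K = (\<lambda>(t, w) k. (1 - t) *\<^sub>R w k + t *\<^sub>R h w k)"
    have "block_degree (\<lambda>w. K (0, w)) = block_degree (\<lambda>w. K (1, w))"
    proof (rule block_degree_homotopy)
      have "continuous_on ({0..1} \<times> block_sphere) (\<lambda>x. K x k)" for k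
        unfolding K_def case_prod_unfold
        by (intro continuous_on_add continuous_on_scaleR continuous_on_diff continuous_on_const
            continuous_on_fst continuous_on_id wc
            continuous_on_product_then_coordinatewise[OF hc[OF continuous_on_snd[OF continuous_on_id]]])
      then show "continuous_on ({0..1} \<times> block_sphere) K"
        by (rule continuous_on_coordinatewise_then_product)
      show "K (t, w) k \<in> blk" if "w \<in> block_sphere" "k < r" for t w k
        using that sphere_blk h_blk by (auto simp: K_def intro!: span_add span_scale)
      fix t :: real and w
      assume w: "w \<in> block_sphere" and t: "t \<in> {0..1}" and z: "\<And>k. k < r \<Longrightarrow> K (t, w) k = 0"
      \<comment> \<open>On the unit sphere all entries lie in the unit ball. Hence the entries 0 and
        1 of \<open>K\<close> are \<open>w 0\<close> and \<open>w 1\<close> at all times, and once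
        \<open>w 0\<close> is zero the others are those of \<open>w\<close>.\<close>
      have small: "f k w = clip (w (\<sigma> k))" if "k < r" for k
        using that sphere_blk[OF w] sphere_norm[OF w] r01 by (intro f_small) (auto simp: \<sigma>_def)
      have "w 0 = 0" "w (Suc 0) = 0"
        using z[of 0] z[of "Suc 0"] small[of 0] small[of "Suc 0"] r01 sphere_norm[OF w]
        by (simp_all add: K_def h01 \<sigma>_def clip_eq_self flip: scaleR_add_left)
      moreover have "w k = 0" if "k < r" "k \<ge> 2" for k
        using z[OF that(1)] hk[OF that, of w] \<open>w 0 = 0\<close>
        by (simp add: K_def \<mu>_def flip: scaleR_add_left)
      ultimately have "w k = 0" if "k < r" for k
        using that by (cases "k \<ge> 2") (auto simp: not_le less_2_cases_iff)
      then show False using sphere_nz[OF w] by blast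
    qed
    moreover have "(\<lambda>w. K (0, w)) = (\<lambda>w. w)" "(\<lambda>w. K (1, w)) = h"
      by (auto simp: K_def fun_eq_iff)
    ultimately show ?thesis by simp
  qed
  \<comment> \<open>Some entry of a point of the unit sphere has norm at least \<open>1 / r\<close>;
    after scaling by \<open>R\<close> its norm is at least 2, where \<open>f k\<close> is the
    direction of the entry.\<close>
  define R where "R = 2 * real r"
  have mid: "block_degree h = block_degree (\<lambda>w. h (\<lambda>k. R *\<^sub>R w k))"
  proof -
    \<comment> \<open>The sphere is inflated from radius 1 to radius \<open>R\<close>, and
      \<open>h\<close> has no zero on the way.\<close>
    define K where "K = (\<lambda>(t, w). h (\<lambda>k. ((1 - t) + t * R) *\<^sub>R w k))"
    have "block_degree (\<lambda>w. K (0, w)) = block_degree (\<lambda>w. K (1, w))"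
    proof (rule block_degree_homotopy)
      show "continuous_on ({0..1} \<times> block_sphere) K"
        unfolding K_def case_prod_unfold
        by (intro hc continuous_on_coordinatewise_then_product continuous_on_add continuous_on_scaleR
            continuous_on_mult continuous_on_diff continuous_on_const continuous_on_fst continuous_on_id wc)
      show "K (t, w) k \<in> blk" if "w \<in> block_sphere" "k < r" for t w k
        using that sphere_blk by (auto simp: K_def intro!: h_blk span_scale)
      fix t :: real and w
      assume w: "w \<in> block_sphere" and t: "t \<in> {0..1}" and z: "\<And>k. k < r \<Longrightarrow> K (t, w) k = 0"
      have "((1 - t) + t * R) *\<^sub>R w k = 0" if "k < r" for k
        by (rule h_zero[of "\<lambda>k. ((1 - t) + t * R) *\<^sub>R w k"])
           (use z that w sphere_blk in \<open>auto simp: K_def intro!: span_scale\<close>)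
      moreover have "(1 - t) + t * R > 0"
        using t r01 by (cases "t = 0") (auto simp: R_def intro!: add_nonneg_pos)
      ultimately have "w k = 0" if "k < r" for k
        using that by (metis less_irrefl scaleR_eq_0_iff)
      then show False using sphere_nz[OF w] by blast
    qed
    then show ?thesis by (simp add: K_def)
  qed
  have far: "block_degree (\<lambda>w. h (\<lambda>k. R *\<^sub>R w k)) = block_degree (\<lambda>w. w(0 := w 1, 1 := w 0))"
  proof -
    define s where "s w = w(0 := w 1, 1 := w 0)" for w :: "nat \<Rightarrow> 'a"
    define K where "K = (\<lambda>(t, w) k. (1 - t) *\<^sub>R h (\<lambda>k. R *\<^sub>R w k) k + t *\<^sub>R s w k)"
    have "block_degree (\<lambda>w. K (0, w)) = block_degree (\<lambda>w. K (1, w))"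
    proof (rule block_degree_homotopy)
      have "continuous_on ({0..1} \<times> block_sphere) (\<lambda>x. K x k)" for k
      proof -
        have "continuous_on ({0..1::real} \<times> block_sphere) (\<lambda>x. h (\<lambda>k. R *\<^sub>R snd x k))"
          by (intro hc continuous_on_coordinatewise_then_product continuous_on_scaleR continuous_on_const wc)
        then have 1: "continuous_on ({0..1::real} \<times> block_sphere) (\<lambda>x. h (\<lambda>k. R *\<^sub>R snd x k) k)"
          by (rule continuous_on_product_then_coordinatewise)
        have "s w k = w (if k = 0 then 1 else if k = 1 then 0 else k)" for w
          by (auto simp: s_def)
        then have 2: "continuous_on ({0..1::real} \<times> block_sphere) (\<lambda>x. s (snd x) k)"
          by (simp only:) (rule wc)
        show ?thesis
          unfolding K_def case_prod_unfold
          by (intro continuous_on_add continuous_on_scaleR continuous_on_diff continuous_on_const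
              continuous_on_fst continuous_on_id 1 2)
      qed
      then show "continuous_on ({0..1} \<times> block_sphere) K"
        by (rule continuous_on_coordinatewise_then_product)
      show "K (t, w) k \<in> blk" if "w \<in> block_sphere" "k < r" for t w k
        using that sphere_blk[OF that(1)] r01
        by (auto simp: K_def s_def intro!: span_add span_scale h_blk)
      fix t :: real and w
      assume w: "w \<in> block_sphere" and t: "t \<in> {0..1}" and z: "\<And>k. k < r \<Longrightarrow> K (t, w) k = 0"
      have large: "f k (\<lambda>k. R *\<^sub>R w k) = sgn (w k)" if "k < r" "norm (w k) \<ge> 1 / real r" for k
      proof -
        have "norm (R *\<^sub>R w k) \<ge> 2" using that r01 by (simp add: R_def field_simps)
        then have "f k (\<lambda>k. R *\<^sub>R w k) = sgn (R *\<^sub>R w k)"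
          using that sphere_blk[OF w] r01 by (intro f_large) (auto simp: \<sigma>_def intro!: span_scale)
        also have "\<dots> = sgn (w k)" using r01 by (simp add: sgn_scaleR R_def)
        finally show ?thesis .
      qed
      \<comment> \<open>For an entry \<open>w k\<close> of norm at least \<open>1 / r\<close>, both
        \<open>h\<close> and the exchange give a nonnegative multiple of \<open>w k\<close> at the
        same position, and no convex combination of them cancels.\<close>
      have comb: "x = 0" if "(1 - t) *\<^sub>R (a *\<^sub>R x) + t *\<^sub>R x = 0" "a > 0" for a and x :: 'a
      proof -
        have "((1 - t) * a + t) *\<^sub>R x = 0" using that by (simp add: scaleR_left_distrib)
        moreover have "(1 - t) * a + t > 0"
          using t that by (cases "t = 1") (auto intro!: add_pos_nonneg)
        ultimately show ?thesis by simp
      qed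
      have lt: "norm (w k) < 1 / real r" if k: "k < r" for k
      proof (rule ccontr)
        assume "\<not> norm (w k) < 1 / real r"
        then have ge: "norm (w k) \<ge> 1 / real r" by simp
        then have wk: "w k \<noteq> 0" "norm (w k) > 0" using r01 by (auto simp: field_simps)
        have sg: "sgn (w k) = (1 / norm (w k)) *\<^sub>R w k" by (simp add: sgn_div_norm divide_inverse)
        consider "k = 0" | "k = Suc 0" | "k \<ge> 2" by linarith
        then have "w k = 0"
        proof cases
          case 1
          then have "(1 - t) *\<^sub>R sgn (w k) + t *\<^sub>R w k = 0"
            using z[of "Suc 0"] r01 large[OF k ge] by (simp add: K_def h01 s_def)
          then show ?thesis unfolding sg by (rule comb) (use wk in simp)
        next
          case 2
          then have "(1 - t) *\<^sub>R sgn (w k) + t *\<^sub>R w k = 0"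
            using z[of 0] r01 large[OF k ge] by (simp add: K_def h01 s_def)
          then show ?thesis unfolding sg by (rule comb) (use wk in simp)
        next
          case 3
          define m where "m = \<mu> (\<lambda>k. R *\<^sub>R w k)"
          have m: "0 \<le> m" "m \<le> 1" by (auto simp: m_def \<mu>_def)
          have "s w k = w k" using 3 by (simp add: s_def)
          then have "(1 - t) *\<^sub>R (m *\<^sub>R sgn (w k) + (1 - m) *\<^sub>R R *\<^sub>R w k) + t *\<^sub>R w k = 0"
            using z[OF k] hk[OF k 3, of "\<lambda>k. R *\<^sub>R w k"] large[OF k ge] by (simp add: K_def m_def)
          moreover have "m *\<^sub>R sgn (w k) + (1 - m) *\<^sub>R R *\<^sub>R w k = (m / norm (w k) + (1 - m) * R) *\<^sub>R w k"
            unfolding sg by (simp add: scaleR_left_distrib)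
          ultimately have "(1 - t) *\<^sub>R ((m / norm (w k) + (1 - m) * R) *\<^sub>R w k) + t *\<^sub>R w k = 0"
            by (simp only:)
          then show ?thesis
          proof (rule comb)
            show "0 < m / norm (w k) + (1 - m) * R"
              using m wk r01 by (cases "m = 0") (auto simp: R_def intro!: add_pos_nonneg)
          qed
        qed
        then show False using wk by simp
      qed
      \<comment> \<open>All \<open>r\<close> squared norms would be below \<open>1 / r^2\<close>,
        with sum below \<open>1 / r\<close>, although the sum is 1.\<close>
      have "(norm (w k))\<^sup>2 < (1 / real r)\<^sup>2" if "k < r" for k
        using lt[OF that] by (intro power_strict_mono) auto
      then have "(\<Sum>k<r. (norm (w k))\<^sup>2) < (\<Sum>k<r. (1 / real r)\<^sup>2)"
        using r01 by (intro sum_strict_mono) auto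
      also have "\<dots> = 1 / real r" using r01 by (simp add: power2_eq_square)
      also have "\<dots> \<le> 1" using r01 by simp
      finally show False using w by (simp add: block_sphere_def)
    qed
    moreover have "(\<lambda>w. K (0, w)) = (\<lambda>w. h (\<lambda>k. R *\<^sub>R w k))" "(\<lambda>w. K (1, w)) = s"
      by (auto simp: K_def fun_eq_iff)
    ultimately show ?thesis by (simp add: s_def[abs_def])
  qed
  have "(1::int) = (- 1) ^ d"
    using near mid far block_degree_id block_degree_swap[OF r2] by simp
  then show False using odd by simp
qed

end


section \<open>Path spaces and local sections\<close>

text \<open>Local compactness of [0,1]: a path sends a compact neighbourhood of \<open>t\<close>
  into \<open>W\<close>, and the paths with this property form a subbasic open set.\<close>

lemma continuous_map_path_space_eval:
  "continuous_map (prod_topology (path_space E) (top_of_set {0..1})) E (\<lambda>(\<gamma>, t). \<gamma> t)"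
proof -
  have "openin (prod_topology (path_space E) (top_of_set {0..1}))
      {x \<in> topspace (prod_topology (path_space E) (top_of_set {0..1})). (case x of (\<gamma>, t) \<Rightarrow> \<gamma> t) \<in> W}"
    (is "openin ?P ?S") if W: "openin E W" for W
    unfolding openin_prod_topology_alt
  proof (intro allI impI)
    fix \<gamma> and t :: real
    assume "(\<gamma>, t) \<in> ?S"
    then have \<gamma>: "\<gamma> \<in> path_set E" and t: "t \<in> {0..1}" "\<gamma> t \<in> W"
      by (auto simp: topspace_path_space)
    then have "continuous_map (top_of_set {0..1}) E \<gamma>"
      by (simp add: path_set_def pathin_def)
    then have "openin (top_of_set {0..1}) {s \<in> {0..1}. \<gamma> s \<in> W}"
      using W openin_continuous_map_preimage by fastforce
    then obtain e where e: "e > 0" "cball t e \<inter> {0..1} \<subseteq> {s \<in> {0..1}. \<gamma> s \<in> W}"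
      using t by (auto simp: openin_contains_cball)
    define K where "K = cball t e \<inter> {0..1}"
    have "{\<gamma> \<in> path_set E. \<gamma> ` K \<subseteq> W} \<in> {{\<gamma> \<in> path_set E. \<gamma> ` K \<subseteq> V} | K V. compact K \<and> K \<subseteq> {0..1} \<and> openin E V}"
      using W by (auto simp: K_def intro!: exI[of _ K] exI[of _ W] compact_Int)
    then have "openin (path_space E) {\<gamma> \<in> path_set E. \<gamma> ` K \<subseteq> W}"
      unfolding path_space_def by (rule topology_generated_by_Basis)
    moreover have "openin (top_of_set {0..1}) ({0..1} \<inter> ball t e)"
      by (simp add: openin_open_Int)
    moreover have "\<gamma> \<in> {\<gamma> \<in> path_set E. \<gamma> ` K \<subseteq> W}" "t \<in> {0..1} \<inter> ball t e"
      using \<gamma> t e by (auto simp: K_def)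
    moreover have "{\<gamma> \<in> path_set E. \<gamma> ` K \<subseteq> W} \<times> ({0..1} \<inter> ball t e) \<subseteq> ?S"
      by (auto simp: K_def topspace_path_space)
    ultimately show "\<exists>U V. openin (path_space E) U \<and> openin (top_of_set {0..1}) V \<and> \<gamma> \<in> U \<and> t \<in> V \<and> U \<times> V \<subseteq> ?S"
      by blast
  qed
  moreover have "(\<lambda>(\<gamma>, t). \<gamma> t) \<in> topspace (prod_topology (path_space E) (top_of_set {0..1})) \<rightarrow> topspace E"
    by (auto simp: topspace_path_space path_set_def pathin_def continuous_map_def Pi_iff)
  ultimately show ?thesis
    by (simp add: continuous_map_def)
qed

text \<open>The converse passage from two variables to path-valued maps. The tube lemma along a
  compact set of times shows that preimages of subbasic sets are open.\<close>

lemma continuous_map_into_path_space: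
  assumes F: "continuous_map (prod_topology T (top_of_set {0..1})) E F"
  shows "continuous_map T (path_space E) (\<lambda>u. \<lambda>t\<in>{0..1}. F (u, t))"
proof -
  have path: "(\<lambda>t\<in>{0..1}. F (u, t)) \<in> path_set E" if "u \<in> topspace T" for u
  proof -
    have "continuous_map (top_of_set {0..1}) (prod_topology T (top_of_set {0..1})) (Pair u)"
      using that by (auto simp: continuous_map_pairwise o_def)
    then have "continuous_map (top_of_set {0..1}) E (F \<circ> Pair u)"
      using F continuous_map_compose by blast
    then have "continuous_map (top_of_set {0..1}) E (\<lambda>t\<in>{0..1}. F (u, t))"
      by (rule continuous_map_eq) auto
    then show ?thesis by (simp add: path_set_def pathin_def)
  qed
  show ?thesis
    unfolding path_space_def
  proof (rule continuous_on_generated_topo)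
    fix S assume "S \<in> {{\<gamma> \<in> path_set E. \<gamma> ` K \<subseteq> V} | K V. compact K \<and> K \<subseteq> {0..1} \<and> openin E V}"
    then obtain K V where KV: "S = {\<gamma> \<in> path_set E. \<gamma> ` K \<subseteq> V}" "compact K" "K \<subseteq> {0..1}" "openin E V"
      by blast
    let ?W = "{x \<in> topspace (prod_topology T (top_of_set {0..1})). F x \<in> V}"
    have W: "openin (prod_topology T (top_of_set {0..1})) ?W"
      using F KV(4) by (rule openin_continuous_map_preimage)
    have K: "compactin (top_of_set {0..1}) K"
      using KV by (simp add: compactin_subtopology)
    have eq: "(\<lambda>u. \<lambda>t\<in>{0..1}. F (u, t)) -` S \<inter> topspace T = {u \<in> topspace T. {u} \<times> K \<subseteq> ?W}"
      using KV path by (auto simp: image_subset_iff)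
    have "openin T {u \<in> topspace T. {u} \<times> K \<subseteq> ?W}"
    proof (subst openin_subopen, intro ballI)
      fix u assume "u \<in> {u \<in> topspace T. {u} \<times> K \<subseteq> ?W}"
      then have u: "u \<in> topspace T" "{u} \<times> K \<subseteq> ?W" by simp_all
      obtain U V' where U: "openin T U" "u \<in> U" "K \<subseteq> V'" "U \<times> V' \<subseteq> ?W"
        using tube_lemma_right[OF W K u] by (elim exE conjE)
      have sub: "{x} \<times> K \<subseteq> ?W" if "x \<in> U" for x
        using that by (intro order.trans[OF _ U(4)] Sigma_mono U(3)) simp
      have "x \<in> {u \<in> topspace T. {u} \<times> K \<subseteq> ?W}" if "x \<in> U" for x
        by (rule CollectI, rule conjI[OF subsetD[OF openin_subset[OF U(1)] that] sub[OF that]])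
      then have "U \<subseteq> {u \<in> topspace T. {u} \<times> K \<subseteq> ?W}"
        by (rule subsetI)
      with U(1,2) show "\<exists>U. openin T U \<and> u \<in> U \<and> U \<subseteq> {u \<in> topspace T. {u} \<times> K \<subseteq> ?W}"
        by (intro exI[of _ U] conjI)
    qed
    then show "openin T ((\<lambda>u. \<lambda>t\<in>{0..1}. F (u, t)) -` S \<inter> topspace T)"
      by (simp only: eq)
  next
    have "path_set E \<in> {{\<gamma> \<in> path_set E. \<gamma> ` K \<subseteq> V} | K V. compact K \<and> K \<subseteq> {0..1} \<and> openin E V}"
      by (rule CollectI, rule exI[of _ "{}"], rule exI[of _ "{}"]) auto
    then show "(\<lambda>u. \<lambda>t\<in>{0..1}. F (u, t)) ` topspace T \<subseteq>
        \<Union> {{\<gamma> \<in> path_set E. \<gamma> ` K \<subseteq> V} | K V. compact K \<and> K \<subseteq> {0..1} \<and> openin E V}"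
      using path by blast
  qed
qed

text \<open>Reduces a local section to one map of a tuple and a time, continuous in both
  jointly.\<close>

lemma has_local_sectionI:
  assumes F: "continuous_map (prod_topology (subtopology (fibre_power r E p) U) (top_of_set {0..1})) E F"
    and U: "U \<subseteq> topspace (fibre_power r E p)" and r: "r \<ge> 2"
    and fibre: "\<And>u t. \<lbrakk>u \<in> U; t \<in> {0..1}\<rbrakk> \<Longrightarrow> p (F (u, t)) = p (F (u, 0))"
    and eval: "\<And>u i. \<lbrakk>u \<in> U; i < r\<rbrakk> \<Longrightarrow> F (u, real i / real (r - 1)) = u i"
  shows "has_local_section r E p U"
  unfolding has_local_section_def
proof (intro exI conjI ballI)
  let ?s = "\<lambda>u. \<lambda>t\<in>{0..1::real}. F (u, t)"
  show "continuous_map (subtopology (fibre_power r E p) U) (fibre_path_space E p) ?s"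
    unfolding fibre_path_space_def continuous_map_in_subtopology
  proof (intro conjI funcsetI CollectI ballI)
    show "continuous_map (subtopology (fibre_power r E p) U) (path_space E) ?s"
      using F by (rule continuous_map_into_path_space)
    fix u and t :: real
    assume "u \<in> topspace (subtopology (fibre_power r E p) U)" and t: "t \<in> {0..1}"
    then have "u \<in> U" by simp
    then show "p (?s u t) = p (?s u 0)"
      using fibre[of u t] t by simp
  qed
  fix u assume u: "u \<in> U"
  have "real i / real (r - 1) \<in> {0..1}" if "i < r" for i
    using that r by (auto simp: divide_simps)
  moreover have "u \<in> extensional {..<r}"
    using u U by (auto simp: fibre_power_def PiE_def)
  ultimately show "fibre_path_eval r (?s u) = u"
    using eval[OF u] by (intro ext) (simp add: fibre_path_eval_def extensional_def restrict_def)
qed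

section \<open>The lower bound on a single fibre\<close>

text \<open>The fibre over a point \<open>x0\<close> is the unit sphere of the hyperplane orthogonal
  to \<open>x0\<close>, whose dimension is odd. Travelling along the path chosen by a section, from
  one prescribed time to another, is a homotopy between two projections.\<close>

lemma section_cover_unit_tangent_False:
  fixes r :: nat
  assumes even: "even CARD('n::finite)" and r: "r \<ge> 2" and K: "1 \<le> K" "K \<le> r"
    and U: "\<And>i. i \<in> {1..K} \<Longrightarrow> openin (fibre_power r (top_of_set unit_tangent_sphere) unit_tangent_proj) (U i)"
      "\<And>i. i \<in> {1..K} \<Longrightarrow> has_local_section r (top_of_set unit_tangent_sphere) unit_tangent_proj (U i)"
    and cov: "topspace (fibre_power r (top_of_set unit_tangent_sphere) unit_tangent_proj)
      \<subseteq> (\<Union>i\<in>{1..K}. U i :: (nat \<Rightarrow> (real ^ 'n) \<times> (real ^ 'n)) set)"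
  shows False
proof -
  let ?p = "unit_tangent_proj :: (real ^ 'n) \<times> (real ^ 'n) \<Rightarrow> real ^ 'n"
  let ?E = "top_of_set (unit_tangent_sphere :: ((real ^ 'n) \<times> (real ^ 'n)) set)"
  obtain x0 :: "real ^ 'n" where x0: "norm x0 = 1"
    using vector_choose_size zero_le_one by blast
  define F where "F = {v. x0 \<bullet> v = 0}"
  have F: "subspace F" unfolding F_def by (rule subspace_hyperplane)
  have "x0 \<noteq> 0" using x0 by auto
  then have dimF: "dim F = CARD('n) - 1"
    unfolding F_def by (simp add: dim_hyperplane)
  obtain B where B: "B \<subseteq> F" "pairwise orthogonal B" "\<And>x. x \<in> B \<Longrightarrow> norm x = 1"
      "independent B" "card B = dim F" "span B = F"
    using orthonormal_basis_subspace[OF F] by blast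
  define d where "d = dim F"
  have finB: "finite B" using B(4) by (rule independent_imp_finite)
  then obtain b where b: "bij_betw b {..<d} B"
    using ex_bij_betw_nat_finite[OF finB] B(5) by (auto simp: d_def atLeast0LessThan)
  have "CARD('n) > 0" by simp
  then have oddd: "odd d" using even by (simp add: d_def dimF)
  interpret orthonormal_blocks r d b
  proof
    show "r > 0" using r by simp
    show "d > 0" using oddd by (cases d) auto
    fix i j assume ij: "i < d" "j < d"
    then have bij: "b i \<in> B" "b j \<in> B" using b by (auto dest: bij_betwE)
    show "b i \<bullet> b j = of_bool (i = j)"
    proof (cases "i = j")
      case True
      then show ?thesis using B(3)[OF bij(1)] by (simp add: norm_eq_1)
    next
      case False
      then have "b i \<noteq> b j" using b ij by (auto simp: bij_betw_def inj_on_def)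
      then show ?thesis using B(2) bij False by (simp add: pairwise_def orthogonal_def)
    qed
  qed
  have blk: "blk = F"
    using b B(6) by (simp add: bij_betw_def)
  define \<Omega> where "\<Omega> = {w. \<forall>k<r. w k \<in> blk \<and> 1 \<le> norm (w k)}"
  define \<sigma> where "\<sigma> = (\<lambda>k::nat. if k = 0 then 1 else 0 :: nat)"
  have \<sigma>_less: "\<sigma> k < r" for k using r by (simp add: \<sigma>_def)
  \<comment> \<open>Pulling back along \<open>u\<close> replaces tuples in the fibre by tuples of
    vectors of norm at least 1; the restriction to indices below \<open>r\<close> matches the
    extensional product.\<close>
  define u where "u w = (\<lambda>j\<in>{..<r}. (x0, sgn (w j)))" for w :: "nat \<Rightarrow> real ^ 'n"
  have sgn_mem: "(x0, sgn (w j)) \<in> unit_tangent_sphere" if "w \<in> \<Omega>" "j < r" for w j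
  proof -
    have "w j \<in> F" "w j \<noteq> 0" using that by (auto simp: \<Omega>_def blk)
    then have "x0 \<bullet> sgn (w j) = 0" "norm (sgn (w j)) = 1"
      by (simp_all add: F_def sgn_div_norm norm_sgn)
    then show ?thesis using x0 by (simp add: unit_tangent_sphere_def norm_eq_1)
  qed
  have u: "continuous_map (top_of_set \<Omega>) (fibre_power r ?E ?p) u"
    unfolding fibre_power_def continuous_map_in_subtopology[of _ "product_topology _ _"]
  proof (intro conjI)
    have "\<forall>j\<in>{..<r}. continuous_map (top_of_set \<Omega>) ?E (\<lambda>x. u x j)"
    proof
    fix j assume j: "j \<in> {..<r}"
    have "continuous_on \<Omega> (\<lambda>w. (x0, sgn (w j)))"
      by (intro continuous_on_Pair continuous_on_const continuous_on_sgn
          continuous_on_product_then_coordinatewise[OF continuous_on_id])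
         (use j in \<open>auto simp: \<Omega>_def\<close>)
    then show "continuous_map (top_of_set \<Omega>) ?E (\<lambda>x. u x j)"
      using j sgn_mem by (auto simp: u_def)
    qed
    then show "continuous_map (top_of_set \<Omega>) (product_topology (\<lambda>i. ?E) {..<r}) u"
      unfolding continuous_map_componentwise by (auto simp: u_def)
  next
    show "u \<in> topspace (top_of_set \<Omega>) \<rightarrow> {u. \<forall>i<r. \<forall>j<r. ?p (u i) = ?p (u j)}"
      by (auto simp: u_def unit_tangent_proj_def)
  qed
  \<comment> \<open>The \<open>K\<close> sets are numbered from 1, while the family \<open>V\<close>
    is numbered from 0 to \<open>r - 1\<close>; the last set is repeated if \<open>K\<close> is less
    than \<open>r\<close>.\<close>
  define i where "i k = min (Suc k) K" for k
  have i: "i k \<in> {1..K}" for k using K by (simp add: i_def)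
  define V where "V k = {w \<in> \<Omega>. u w \<in> U (i k)}" for k
  have "\<forall>k. \<exists>s. continuous_map (subtopology (fibre_power r ?E ?p) (U (i k))) (fibre_path_space ?E ?p) s \<and>
      (\<forall>u\<in>U (i k). fibre_path_eval r (s u) = u)"
    using U(2)[OF i] by (simp add: has_local_section_def)
  then obtain s where s: "\<And>k. continuous_map (subtopology (fibre_power r ?E ?p) (U (i k))) (fibre_path_space ?E ?p) (s k)"
    and s_eval: "\<And>k u. u \<in> U (i k) \<Longrightarrow> fibre_path_eval r (s k u) = u"
    by metis
  have su: "continuous_map (top_of_set (V k)) (fibre_path_space ?E ?p) (\<lambda>w. s k (u w))" for k
  proof -
    have "continuous_map (top_of_set (V k)) (subtopology (fibre_power r ?E ?p) (U (i k))) u"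
      unfolding continuous_map_in_subtopology
      using continuous_map_from_subtopology_mono[OF u, of "V k"] by (auto simp: V_def)
    from continuous_map_compose[OF this s[of k]] show ?thesis by (simp add: o_def)
  qed
  \<comment> \<open>The time runs linearly from the one at which the path visits entry \<sigma> k to
    the one at which it visits entry k; for \<open>k = 0\<close> it runs backwards.\<close>
  define \<tau> where "\<tau> k t = ((1 - t) * real (\<sigma> k) + t * real k) / real (r - 1)" for k t
  have \<tau>: "\<tau> k t \<in> {0..1}" if "k < r" "t \<in> {0..1}" for k t
  proof -
    have "(1 - t) * real (\<sigma> k) + t * real k \<le> (1 - t) * real (r - 1) + t * real (r - 1)"
      using that \<sigma>_less[of k] by (intro add_mono mult_left_mono) auto
    then have "(1 - t) * real (\<sigma> k) + t * real k \<le> real (r - 1)"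
      by (simp add: algebra_simps)
    then show ?thesis using that r by (auto simp: \<tau>_def divide_simps)
  qed
  define G where "G k = (\<lambda>(w, t). snd (s k (u w) (\<tau> k t)))" for k
  have path: "s k (u w) t \<in> unit_tangent_sphere" "fst (s k (u w) t) = x0"
    "real j / real (r - 1) \<in> {0..1} \<Longrightarrow> j < r \<Longrightarrow> snd (s k (u w) (real j / real (r - 1))) = sgn (w j)"
    if w: "w \<in> V k" and t: "t \<in> {0..1}" for k w t j
  proof -
    have "s k (u w) \<in> topspace (fibre_path_space ?E ?p)"
      using su[of k] w by (auto simp: continuous_map_def)
    then have *: "s k (u w) \<in> path_set ?E" "\<forall>t\<in>{0..1}. ?p (s k (u w) t) = ?p (s k (u w) 0)"
      unfolding fibre_path_space_def topspace_subtopology topspace_path_space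
      unfolding Int_iff mem_Collect_eq by (rule conjunct1, rule conjunct2)
    then show "s k (u w) t \<in> unit_tangent_sphere"
      using t by (auto simp: path_set_def pathin_def)
    have ev: "fibre_path_eval r (s k (u w)) j = u w j" for j
      using s_eval[of "u w" k] w by (simp add: V_def)
    have ev': "s k (u w) (real j / real (r - 1)) = (x0, sgn (w j))" if "j < r" for j
      using ev[of j] that by (simp add: fibre_path_eval_def u_def)
    show "fst (s k (u w) t) = x0"
      using bspec[OF *(2) t] ev'[of 0] r by (simp add: unit_tangent_proj_def case_prod_unfold)
    show "snd (s k (u w) (real j / real (r - 1))) = sgn (w j)" if "j < r"
      using ev'[OF that] by simp
  qed
  show False
  proof (rule homotopic_projections_cover_False[of V G])
    show "r \<ge> 2" "odd d" by fact+
    show "openin (top_of_set {w. \<forall>k<r. w k \<in> blk \<and> 1 \<le> norm (w k)}) (V k)" for k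
      using openin_continuous_map_preimage[OF u U(1)[OF i[of k]]] by (simp add: V_def \<Omega>_def)
    show "{w. \<forall>k<r. w k \<in> blk \<and> 1 \<le> norm (w k)} \<subseteq> (\<Union>k<r. V k)"
    proof
      fix w assume "w \<in> {w. \<forall>k<r. w k \<in> blk \<and> 1 \<le> norm (w k)}"
      then have w: "w \<in> \<Omega>" by (simp add: \<Omega>_def)
      then have "u w \<in> topspace (fibre_power r ?E ?p)"
        using u by (auto simp: continuous_map_def)
      then obtain j where j: "j \<in> {1..K}" "u w \<in> U j" using cov by blast
      then have "w \<in> V (j - 1)" using w by (simp add: V_def i_def min_absorb1)
      moreover have "j - 1 < r" using j K by auto
      ultimately show "w \<in> (\<Union>k<r. V k)" by blast
    qed
    fix k assume k: "k < r"
    show "continuous_on (V k \<times> {0..1}) (G k)"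
    proof -
      have "continuous_map (top_of_set (V k \<times> {0..1::real})) (path_space ?E) (\<lambda>x. s k (u (fst x)))"
      proof -
        have s1: "continuous_map (top_of_set (V k)) (path_space ?E) (\<lambda>w. s k (u w))"
          using su[of k] unfolding fibre_path_space_def by (simp add: continuous_map_in_subtopology)
        have f1: "continuous_map (top_of_set (V k \<times> {0..1::real})) (top_of_set (V k)) fst"
          by (auto intro: continuous_on_fst continuous_on_id)
        show ?thesis
          using continuous_map_compose[OF f1 s1] by (simp only: o_def)
      qed
      moreover have "continuous_map (top_of_set (V k \<times> {0..1})) (top_of_set {0..1}) (\<lambda>x. \<tau> k (snd x))"
      proof -
        have "continuous_on (V k \<times> {0..1}) (\<lambda>x. \<tau> k (snd x))"
          unfolding \<tau>_def divide_inverse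
          by (intro continuous_on_mult continuous_on_add continuous_on_diff continuous_on_const
              continuous_on_snd continuous_on_id)
        then show ?thesis using \<tau>[OF k] by auto
      qed
      ultimately have "continuous_map (top_of_set (V k \<times> {0..1})) (prod_topology (path_space ?E) (top_of_set {0..1}))
          (\<lambda>x. (s k (u (fst x)), \<tau> k (snd x)))"
        by (simp add: continuous_map_pairwise o_def)
      from continuous_map_compose[OF this continuous_map_path_space_eval]
      have "continuous_on (V k \<times> {0..1}) (\<lambda>x. s k (u (fst x)) (\<tau> k (snd x)))"
        by (simp add: o_def)
      then show ?thesis
        unfolding G_def case_prod_unfold by (rule continuous_on_snd)
    qed
    show "G k (w, t) \<in> blk - {0}" if w: "w \<in> V k" and t: "t \<in> {0..1}" for w t
    proof -
      have "s k (u w) (\<tau> k t) \<in> unit_tangent_sphere" "fst (s k (u w) (\<tau> k t)) = x0"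
        using path(1,2)[OF w \<tau>[OF k t]] by auto
      then show ?thesis
        by (auto simp: G_def blk F_def unit_tangent_sphere_def case_prod_unfold)
    qed
    have \<tau>01: "\<tau> k 0 = real (\<sigma> k) / real (r - 1)" "\<tau> k 1 = real k / real (r - 1)"
      by (simp_all add: \<tau>_def)
    have "\<tau> k 0 \<in> {0..1}" "\<tau> k 1 \<in> {0..1}" using \<tau>[OF k] by auto
    then show "G k (w, 0) = sgn (w (if k = 0 then 1 else 0))" "G k (w, 1) = sgn (w k)" if w: "w \<in> V k" for w
      using path(3)[OF w, of 0 "\<sigma> k"] path(3)[OF w, of 0 k] \<sigma>_less[of k] k \<tau>01
      by (simp_all add: G_def \<sigma>_def)
  qed
qed


section \<open>Motion planner\<close>

text \<open>The coordinates are grouped into \<open>m\<close> quaternions, and \<open>I\<close> and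
  \<open>J\<close> are left multiplication by the units i and j.\<close>

lemma quaternionic_fields:
  assumes card: "CARD('n::finite) = 4 * m"
  obtains I J :: "real ^ 'n \<Rightarrow> real ^ 'n" where "linear I" "linear J"
    "\<And>x. I x \<bullet> x = 0" "\<And>x. J x \<bullet> x = 0" "\<And>x. I x \<bullet> J x = 0"
    "\<And>x. norm (I x) = norm x" "\<And>x. norm (J x) = norm x"
proof -
  let ?P = "{..<m} \<times> {..<4::nat}"
  have "card ?P = card (UNIV :: 'n set)"
    using card by (simp add: card_cartesian_product)
  then obtain g :: "nat \<times> nat \<Rightarrow> 'n" where g: "bij_betw g ?P UNIV"
    using finite_same_card_bij[of ?P "UNIV :: 'n set"] by auto
  define e where "e = the_inv_into ?P g"
  have e: "e (g (j, q)) = (j, q)" if "j < m" "q < 4" for j q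
    using g that by (simp add: e_def the_inv_into_f_f bij_betw_def)
  define I where "I x = (\<chi> i. case e i of (j, q) \<Rightarrow>
      if q = 0 then - x $ g (j, 1) else if q = 1 then x $ g (j, 0)
      else if q = 2 then - x $ g (j, 3) else x $ g (j, 2))" for x :: "real ^ 'n"
  define J where "J x = (\<chi> i. case e i of (j, q) \<Rightarrow>
      if q = 0 then - x $ g (j, 2) else if q = 1 then x $ g (j, 3)
      else if q = 2 then x $ g (j, 0) else - x $ g (j, 1))" for x :: "real ^ 'n"
  \<comment> \<open>With the inner product written by quaternions, all the required identities hold
    summand by summand.\<close>
  have sum4: "y \<bullet> z = (\<Sum>j<m. y $ g (j, 0) * z $ g (j, 0) + y $ g (j, 1) * z $ g (j, 1)
      + y $ g (j, 2) * z $ g (j, 2) + y $ g (j, 3) * z $ g (j, 3))" for y z :: "real ^ 'n"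
  proof -
    have four: "{..<4} = {0, 1, 2, 3::nat}" by auto
    have "y \<bullet> z = (\<Sum>p\<in>?P. y $ g p * z $ g p)"
      using sum.reindex_bij_betw[OF g, of "\<lambda>i. y $ i * z $ i"] by (simp add: inner_vec_def)
    also have "\<dots> = (\<Sum>j<m. \<Sum>q<4. y $ g (j, q) * z $ g (j, q))"
      by (simp add: sum.cartesian_product)
    finally show ?thesis by (simp add: four add.assoc)
  qed
  have I_at: "I x $ g (j, 0) = - x $ g (j, 1)" "I x $ g (j, 1) = x $ g (j, 0)"
      "I x $ g (j, 2) = - x $ g (j, 3)" "I x $ g (j, 3) = x $ g (j, 2)"
    and J_at: "J x $ g (j, 0) = - x $ g (j, 2)" "J x $ g (j, 1) = x $ g (j, 3)"
      "J x $ g (j, 2) = x $ g (j, 0)" "J x $ g (j, 3) = - x $ g (j, 1)" if "j < m" for x j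
    using that by (simp_all add: I_def J_def e)
  show thesis
  proof (rule that[of I J])
    show "linear I" "linear J"
      by (auto intro!: linearI simp: I_def J_def vec_eq_iff split: prod.splits)
    fix x
    show "I x \<bullet> x = 0" "J x \<bullet> x = 0" "I x \<bullet> J x = 0"
      unfolding sum4 by (auto intro!: sum.neutral simp: I_at[unfolded One_nat_def] J_at[unfolded One_nat_def])
    have "I x \<bullet> I x = x \<bullet> x" "J x \<bullet> J x = x \<bullet> x"
      unfolding sum4 by (auto intro!: sum.cong simp: I_at[unfolded One_nat_def] J_at[unfolded One_nat_def])
    then show "norm (I x) = norm x" "norm (J x) = norm x"
      by (simp_all add: norm_eq_sqrt_inner)
  qed
qed

section \<open>Polygonal paths that miss the origin\<close>

definition hat :: "real \<Rightarrow> real" where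
  "hat s = max 0 (1 - \<bar>s\<bar>)"

text \<open>Piecewise linear interpolation of \<open>P 0\<close>, ..., \<open>P N\<close> at integer
  times. Writing it with tent functions gives joint continuity in the vertices and the time with no
  gluing of pieces.\<close>

definition polyline :: "nat \<Rightarrow> (nat \<Rightarrow> 'a::real_vector) \<Rightarrow> real \<Rightarrow> 'a" where
  "polyline N P s = (\<Sum>i\<le>N. hat (s - real i) *\<^sub>R P i)"

lemma polyline_segment:
  assumes "i < N" "t \<in> {0..1}"
  shows "polyline N P (real i + t) = (1 - t) *\<^sub>R P i + t *\<^sub>R P (Suc i)"
proof -
  have "polyline N P (real i + t) = (\<Sum>j\<in>{i, Suc i}. hat (real i + t - real j) *\<^sub>R P j)"
    unfolding polyline_def
  proof (rule sum.mono_neutral_right)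
    show "\<forall>j\<in>{..N} - {i, Suc i}. hat (real i + t - real j) *\<^sub>R P j = 0"
    proof
      fix j assume "j \<in> {..N} - {i, Suc i}"
      then have "j < i \<or> j > Suc i" by auto
      then have "real j + 1 \<le> real i \<or> real j \<ge> real i + 2" by linarith
      then have "hat (real i + t - real j) = 0" using assms by (auto simp: hat_def)
      then show "hat (real i + t - real j) *\<^sub>R P j = 0" by simp
    qed
  qed (use assms in auto)
  then show ?thesis using assms by (simp add: hat_def)
qed

lemma polyline_vertex:
  assumes "i \<le> N"
  shows "polyline N P (real i) = P i"
proof -
  have "polyline N P (real i) = (\<Sum>j\<in>{i}. hat (real i - real j) *\<^sub>R P j)"
    unfolding polyline_def
    by (rule sum.mono_neutral_right) (use assms in \<open>auto simp: hat_def\<close>)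
  then show ?thesis by (simp add: hat_def)
qed

definition avoids_0 :: "'a::real_vector \<Rightarrow> 'a \<Rightarrow> bool" where
  "avoids_0 a b \<longleftrightarrow> (\<forall>t\<in>{0..1}. (1 - t) *\<^sub>R a + t *\<^sub>R b \<noteq> 0)"

lemma avoids_0_commute: "avoids_0 a b \<Longrightarrow> avoids_0 b a"
  unfolding avoids_0_def
proof
  fix t :: real
  assume *: "\<forall>t\<in>{0..1}. (1 - t) *\<^sub>R a + t *\<^sub>R b \<noteq> 0" and t: "t \<in> {0..1}"
  then have "1 - t \<in> {0..1}" by auto
  from bspec[OF * this] show "(1 - t) *\<^sub>R b + t *\<^sub>R a \<noteq> 0" by (simp add: add.commute)
qed

lemma avoids_0_orthogonal:
  fixes a b :: "'a::real_inner"
  assumes "a \<bullet> b = 0" "a \<noteq> 0" "b \<noteq> 0"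
  shows "avoids_0 a b"
  unfolding avoids_0_def
proof (intro ballI notI)
  fix t :: real
  assume z: "(1 - t) *\<^sub>R a + t *\<^sub>R b = 0"
  have "a \<bullet> ((1 - t) *\<^sub>R a + t *\<^sub>R b) = (1 - t) * (a \<bullet> a)"
    using assms by (simp add: inner_add_right)
  then have "t = 1" using z assms by simp
  then show False using z assms by simp
qed

text \<open>Comparing norms, a zero on the segment can only be its midpoint, and then the endpoints
  are antipodal.\<close>

lemma avoids_0_unit:
  fixes a b :: "'a::real_normed_vector"
  assumes "norm a = 1" "norm b = 1" "a \<noteq> - b"
  shows "avoids_0 a b"
  unfolding avoids_0_def
proof (intro ballI notI)
  fix t :: real
  assume t: "t \<in> {0..1}" and z: "(1 - t) *\<^sub>R a + t *\<^sub>R b = 0"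
  then have eq: "(1 - t) *\<^sub>R a = - (t *\<^sub>R b)" by (simp add: eq_neg_iff_add_eq_0)
  then have "norm ((1 - t) *\<^sub>R a) = norm (t *\<^sub>R b)" by simp
  then have half: "t = 1 / 2" using t assms by simp
  have "(1 - t) *\<^sub>R a = (1 - t) *\<^sub>R (- b)"
    unfolding eq unfolding half by simp
  then have "a = - b" using half by (simp only: scaleR_cancel_left) simp
  then show False using assms by simp
qed

lemma polyline_nonzero:
  assumes seg: "\<And>i. i < N \<Longrightarrow> avoids_0 (P i) (P (Suc i))" and "N > 0" and s: "0 \<le> s" "s \<le> real N"
  shows "polyline N P s \<noteq> 0"
\<comment> \<open>At the final time the integer part of \<open>s\<close> would be \<open>N\<close>,
  which does not begin a segment.\<close>
proof (cases "s = real N")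
  case True
  have "P (Suc (N - 1)) \<noteq> 0"
    using seg[of "N - 1"] \<open>N > 0\<close> by (auto simp: avoids_0_def dest!: bspec[of _ _ 1])
  then show ?thesis using True \<open>N > 0\<close> polyline_vertex[of N N P] by simp
next
  case False
  define i where "i = nat \<lfloor>s\<rfloor>"
  define t where "t = s - real i"
  have i: "real i \<le> s" "s < real i + 1" using s by (auto simp: i_def) 
  then have "i < N" using s False by linarith
  moreover have "t \<in> {0..1}" using i by (simp add: t_def)
  ultimately show ?thesis
    using polyline_segment[of i N t P] seg[of i] by (simp add: t_def avoids_0_def)
qed

text \<open>Sections on disjoint open sets paste together. This is how the many choice sets
  \<open>S\<close> are merged into \<open>r + 1\<close> domains.\<close>

lemma has_local_section_disjoint_Union:
  assumes ope: "\<And>i. i \<in> A \<Longrightarrow> openin (fibre_power r E p) (U i)"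
    and sec: "\<And>i. i \<in> A \<Longrightarrow> has_local_section r E p (U i)"
    and disj: "\<And>i j. \<lbrakk>i \<in> A; j \<in> A; i \<noteq> j\<rbrakk> \<Longrightarrow> U i \<inter> U j = {}"
  shows "has_local_section r E p (\<Union>i\<in>A. U i)"
proof -
  let ?X = "subtopology (fibre_power r E p) (\<Union>i\<in>A. U i)"
  have "\<forall>i\<in>A. \<exists>s. continuous_map (subtopology (fibre_power r E p) (U i)) (fibre_path_space E p) s \<and>
      (\<forall>u\<in>U i. fibre_path_eval r (s u) = u)"
    using sec by (simp add: has_local_section_def)
  then obtain s where "\<forall>i\<in>A. continuous_map (subtopology (fibre_power r E p) (U i)) (fibre_path_space E p) (s i) \<and>
      (\<forall>u\<in>U i. fibre_path_eval r (s i u) = u)"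
    by (rule bchoice[elim_format]) blast
  then have s: "\<And>i. i \<in> A \<Longrightarrow> continuous_map (subtopology (fibre_power r E p) (U i)) (fibre_path_space E p) (s i)"
    and ev: "\<And>i u. \<lbrakk>i \<in> A; u \<in> U i\<rbrakk> \<Longrightarrow> fibre_path_eval r (s i u) = u"
    by auto
  have sub: "subtopology ?X (U i) = subtopology (fibre_power r E p) (U i)" if "i \<in> A" for i
    using that by (simp add: subtopology_subtopology Int_absorb1 UN_upper)
  obtain g where g: "continuous_map ?X (fibre_path_space E p) g"
    "\<And>x i. \<lbrakk>i \<in> A; x \<in> topspace ?X \<inter> U i\<rbrakk> \<Longrightarrow> g x = s i x"
  proof (rule pasting_lemma_exists[where X = ?X and I = A and T = U and f = s and Y = "fibre_path_space E p"])
    show "topspace ?X \<subseteq> (\<Union>i\<in>A. U i)" by simp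
    show "openin ?X (U i)" if "i \<in> A" for i
      unfolding openin_subtopology using ope[OF that] that by (intro exI[of _ "U i"]) auto
    show "continuous_map (subtopology ?X (U i)) (fibre_path_space E p) (s i)" if "i \<in> A" for i
      using s[OF that] sub[OF that] by simp
    show "s i x = s j x" if "i \<in> A" "j \<in> A" "x \<in> topspace ?X \<inter> U i \<inter> U j" for i j x
      using disj[of i j] that by (cases "i = j") auto
  qed (use that in blast)
  have "fibre_path_eval r (g u) = u" if "u \<in> (\<Union>i\<in>A. U i)" for u
  proof -
    obtain i where i: "i \<in> A" "u \<in> U i" using \<open>u \<in> (\<Union>i\<in>A. U i)\<close> by blast
    then have "u \<in> topspace ?X \<inter> U i" using openin_subset[OF ope[OF i(1)]] by auto
    then show ?thesis using g(2)[OF i(1)] ev[OF i] by simp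
  qed
  then show ?thesis unfolding has_local_section_def using g(1) by blast
qed

section \<open>The motion planner on each choice set\<close>

locale quaternionic_sphere =
  fixes I J :: "real ^ 'n::finite \<Rightarrow> real ^ 'n" and r :: nat
  assumes linear: "linear I" "linear J"
    and tangent: "I x \<bullet> x = 0" "J x \<bullet> x = 0" and orth: "I x \<bullet> J x = 0"
    and isometric: "norm (I x) = norm x" "norm (J x) = norm x"
    and r2: "r \<ge> 2"
begin

abbreviation base :: "(nat \<Rightarrow> (real ^ 'n) \<times> (real ^ 'n)) \<Rightarrow> real ^ 'n" where
  "base u \<equiv> fst (u 0)"

abbreviation dir :: "(nat \<Rightarrow> (real ^ 'n) \<times> (real ^ 'n)) \<Rightarrow> nat \<Rightarrow> real ^ 'n" where
  "dir u j \<equiv> snd (u j)"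

text \<open>With x the base point and v_j the directions, index 0 measures how far v_0 points along
  plus or minus I x: value 1 excludes the use of I x, and a positive value permits J x. For the
  other indices it is a quarter of the squared distance from v_0 to v_j, which is 0 if v_j = v_0 and
  1 if v_j = - v_0.\<close>

definition obstruction :: "nat \<Rightarrow> (nat \<Rightarrow> (real ^ 'n) \<times> (real ^ 'n)) \<Rightarrow> real" where
  "obstruction j u = (if j = 0 then (dir u 0 \<bullet> I (base u))\<^sup>2 else (1 - dir u 0 \<bullet> dir u j) / 2)"

text \<open>The first two conditions make the choices in \<open>S\<close> usable by the planner. The
  third separates the domains of different sets \<open>S\<close> of equal size.\<close>

definition stratum :: "nat set \<Rightarrow> (nat \<Rightarrow> (real ^ 'n) \<times> (real ^ 'n)) set" where
  "stratum S = {u. (\<forall>j\<in>S. 0 < obstruction j u) \<and> (\<forall>j\<in>{..<r} - S. obstruction j u < 1) \<and>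
     (\<forall>i\<in>S. \<forall>j\<in>{..<r} - S. obstruction j u < obstruction i u)}"

definition tuples :: "(nat \<Rightarrow> (real ^ 'n) \<times> (real ^ 'n)) set" where
  "tuples = {u. (\<forall>j<r. u j \<in> unit_tangent_sphere \<and> fst (u j) = base u)}"

text \<open>The part of I x or J x orthogonal to v_0, through which the path between v_0 and - v_0
  is led.\<close>

definition transverse :: "nat set \<Rightarrow> (nat \<Rightarrow> (real ^ 'n) \<times> (real ^ 'n)) \<Rightarrow> real ^ 'n" where
  "transverse S u = (let k = (if 0 \<in> S then J else I) (base u) in k - (k \<bullet> dir u 0) *\<^sub>R dir u 0)"

definition pole :: "nat set \<Rightarrow> (nat \<Rightarrow> (real ^ 'n) \<times> (real ^ 'n)) \<Rightarrow> nat \<Rightarrow> real ^ 'n" where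
  "pole S u j = (if j \<in> S \<and> j \<noteq> 0 then - dir u 0 else dir u 0)"

text \<open>From \<open>v\<^sub>j\<close> to \<open>v\<^sub>j\<^sub>+\<^sub>1\<close> the planner runs through \<open>v\<^sub>j\<close>, \<open>\<plusminus>v\<^sub>0\<close>, a vector orthogonal to \<open>v\<^sub>0\<close>,
  \<open>\<plusminus>v\<^sub>0\<close>, \<open>v\<^sub>j\<^sub>+\<^sub>1\<close>; the signs are chosen so that no segment between successive points meets zero.\<close>

definition waypoint :: "nat set \<Rightarrow> (nat \<Rightarrow> (real ^ 'n) \<times> (real ^ 'n)) \<Rightarrow> nat \<Rightarrow> real ^ 'n" where
  "waypoint S u i = (let j = i div 4; q = i mod 4 in
     if q = 0 then dir u j else if q = 1 then pole S u j else if q = 2 then transverse S u else pole S u (Suc j))"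

text \<open>There are four segments from each entry to the next, so time \<open>j / (r - 1)\<close>
  falls on vertex \<open>4 * j\<close>, which is v_j.\<close>

definition planner :: "nat set \<Rightarrow> (nat \<Rightarrow> (real ^ 'n) \<times> (real ^ 'n)) \<times> real \<Rightarrow> (real ^ 'n) \<times> (real ^ 'n)" where
  "planner S = (\<lambda>(u, t). (base u, sgn (polyline (4 * (r - 1)) (waypoint S u) (real (4 * (r - 1)) * t))))"

lemma bounded: "bounded_linear I" "bounded_linear J"
  using linear by (simp_all add: linear_conv_bounded_linear)

lemma tuples_component:
  assumes "u \<in> tuples" "j < r"
  shows "u j \<in> unit_tangent_sphere" "fst (u j) = base u"
  using assms unfolding tuples_def by blast+

lemma tuplesI:
  assumes "\<And>j. j < r \<Longrightarrow> u j \<in> unit_tangent_sphere" "\<And>j. j < r \<Longrightarrow> fst (u j) = base u"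
  shows "u \<in> tuples"
  using assms unfolding tuples_def by blast

lemma tuplesD:
  assumes "u \<in> tuples" "j < r"
  shows "norm (base u) = 1" "norm (dir u j) = 1" "base u \<bullet> dir u j = 0"
  using tuples_component[OF assms]
  by (simp_all add: unit_tangent_sphere_def norm_eq_1 case_prod_unfold)

lemma transverse_properties:
  assumes u: "u \<in> tuples" and S: "u \<in> stratum S"
  shows "dir u 0 \<bullet> transverse S u = 0" "transverse S u \<noteq> 0" "base u \<bullet> transverse S u = 0"
proof -
  define x v where "x = base u" and "v = dir u 0"
  have xv: "norm x = 1" "norm v = 1" "x \<bullet> v = 0"
    using tuplesD[OF u, of 0] r2 by (auto simp: x_def v_def)
  then have vv: "v \<bullet> v = 1" by (simp add: norm_eq_1)
  define k where "k = (if 0 \<in> S then J x else I x)"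
  have k: "k \<bullet> x = 0" "norm k = 1"
    using tangent isometric xv by (auto simp: k_def)
  have n: "transverse S u = k - (k \<bullet> v) *\<^sub>R v"
    by (simp add: transverse_def k_def x_def v_def Let_def)
  show "dir u 0 \<bullet> transverse S u = 0"
    unfolding n using vv by (simp add: inner_diff_right inner_commute flip: v_def)
  show "base u \<bullet> transverse S u = 0"
    unfolding n using xv k by (simp add: inner_diff_right inner_commute flip: x_def)
  show "transverse S u \<noteq> 0"
  proof
    assume "transverse S u = 0"
    \<comment> \<open>A vanishing projection means that the chosen field is plus or minus v_0. For J
      x this makes v_0 orthogonal to I x, so obstruction 0 is zero; for I x it makes obstruction 0
      equal to 1. The stratum excludes both.\<close>
    then have kv: "k = (k \<bullet> v) *\<^sub>R v" by (simp add: n)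
    then have "norm k = \<bar>k \<bullet> v\<bar> * norm v" by (metis norm_scaleR)
    then have "\<bar>k \<bullet> v\<bar> = 1" using k xv by simp
    then have sq: "(k \<bullet> v)\<^sup>2 = 1" by (simp add: power2_eq_1_iff abs_if split: if_splits)
    show False
    proof (cases "0 \<in> S")
      case True
      then have "0 < obstruction 0 u" using S by (auto simp: stratum_def)
      then have "v \<bullet> I x \<noteq> 0" by (auto simp: obstruction_def x_def v_def)
      moreover have "k \<bullet> I x = 0" using True orth[of x] by (simp add: k_def inner_commute)
      then have "(k \<bullet> v) * (v \<bullet> I x) = 0" using kv by (metis inner_scaleR_left)
      ultimately show False using sq by simp
    next
      case False
      then have "obstruction 0 u < 1" using S r2 by (auto simp: stratum_def)
      then show False using sq False by (simp add: obstruction_def k_def x_def v_def inner_commute)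
    qed
  qed
qed

lemma pole_properties:
  assumes u: "u \<in> tuples" and S: "u \<in> stratum S" and j: "j < r"
  shows "norm (pole S u j) = 1" "avoids_0 (dir u j) (pole S u j)" "avoids_0 (pole S u j) (transverse S u)"
    "base u \<bullet> pole S u j = 0"
proof -
  have r0: "0 < r" using r2 by simp
  show n: "norm (pole S u j) = 1"
    using tuplesD(2)[OF u r0] by (simp add: pole_def)
  show "base u \<bullet> pole S u j = 0"
    using tuplesD(3)[OF u r0] by (simp add: pole_def)
  have "pole S u j \<bullet> transverse S u = 0"
    using transverse_properties(1)[OF u S] by (simp add: pole_def)
  then show "avoids_0 (pole S u j) (transverse S u)"
    using n transverse_properties(2)[OF u S] by (intro avoids_0_orthogonal) auto
  have v0: "dir u 0 \<bullet> dir u 0 = 1" using tuplesD(2)[OF u r0] by (simp add: norm_eq_1)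
  \<comment> \<open>Both are unit vectors, so only antipodal position has to be excluded. It would
    make obstruction j equal to 0 for j in S and to 1 for j outside S, if j is positive.\<close>
  have "dir u j \<noteq> - pole S u j"
  proof
    assume eq: "dir u j = - pole S u j"
    show False
    proof (cases "j = 0")
      case True
      then have "dir u 0 = - dir u 0" using eq by (simp add: pole_def)
      then have "dir u 0 \<bullet> dir u 0 = - (dir u 0 \<bullet> dir u 0)" by (metis inner_minus_left)
      then show False using v0 by simp
    next
      case False
      show False
      proof (cases "j \<in> S")
        case True
        then have "0 < obstruction j u" using S by (auto simp: stratum_def)
        moreover have "dir u j = dir u 0" using eq True False by (simp add: pole_def)
        ultimately show False using v0 False by (simp add: obstruction_def)
      next
        case notin: False
        then have "obstruction j u < 1" using S j by (auto simp: stratum_def)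
        moreover have "dir u j = - dir u 0" using eq notin by (simp add: pole_def)
        ultimately show False using v0 False by (simp add: obstruction_def)
      qed
    qed
  qed
  then show "avoids_0 (dir u j) (pole S u j)"
    using avoids_0_unit[OF tuplesD(2)[OF u j] n] by blast
qed

lemma waypoint_cases:
  "waypoint S u (4 * j) = dir u j" "waypoint S u (4 * j + 1) = pole S u j"
  "waypoint S u (4 * j + 2) = transverse S u" "waypoint S u (4 * j + 3) = pole S u (Suc j)"
proof -
  have "(4 * j + 1) mod 4 = 1" "(4 * j + 2) mod 4 = 2" "(4 * j + 3) mod 4 = 3"
    "(4 * j + 1) div 4 = j" "(4 * j + 2) div 4 = j" "(4 * j + 3) div 4 = j"
    by presburger+
  then show "waypoint S u (4 * j) = dir u j" "waypoint S u (4 * j + 1) = pole S u j"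
    "waypoint S u (4 * j + 2) = transverse S u" "waypoint S u (4 * j + 3) = pole S u (Suc j)"
    by (simp_all only: waypoint_def Let_def) simp_all
qed

lemma index_mod4_cases:
  fixes i :: nat
  obtains j where "i = 4 * j" | j where "i = 4 * j + 1" | j where "i = 4 * j + 2" | j where "i = 4 * j + 3"
proof -
  have "i = 4 * (i div 4) \<or> i = 4 * (i div 4) + 1 \<or> i = 4 * (i div 4) + 2 \<or> i = 4 * (i div 4) + 3"
    by presburger
  then show thesis using that by metis
qed

lemma waypoint_avoids_0:
  assumes u: "u \<in> tuples" "u \<in> stratum S" and i: "i < 4 * (r - 1)"
  shows "avoids_0 (waypoint S u i) (waypoint S u (Suc i))"
proof (cases i rule: index_mod4_cases)
  case (1 j)
  then have "j < r" and "Suc i = 4 * j + 1" using i by auto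
  then show ?thesis using 1 waypoint_cases pole_properties(2)[OF u] by metis
next
  case (2 j)
  then have "j < r" and "Suc i = 4 * j + 2" using i by auto
  then show ?thesis using 2 waypoint_cases pole_properties(3)[OF u] by metis
next
  case (3 j)
  then have "Suc j < r" and "Suc i = 4 * j + 3" using i by auto
  then show ?thesis using 3 waypoint_cases pole_properties(3)[OF u] avoids_0_commute by metis
next
  case (4 j)
  then have "Suc j < r" and "Suc i = 4 * Suc j" using i by auto
  then show ?thesis using 4 waypoint_cases pole_properties(2)[OF u] avoids_0_commute by metis
qed

text \<open>Keeps the interpolated path in the tangent space at the base point, so that normalising
  it gives unit tangent vectors there.\<close>

lemma base_inner_waypoint:
  assumes u: "u \<in> tuples" "u \<in> stratum S" and i: "i \<le> 4 * (r - 1)"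
  shows "base u \<bullet> waypoint S u i = 0"
proof (cases i rule: index_mod4_cases)
  case (1 j)
  then have "j < r" using i r2 by auto
  then show ?thesis using 1 waypoint_cases tuplesD(3)[OF u(1)] by metis
next
  case (2 j)
  then have "j < r" using i by auto
  then show ?thesis using 2 waypoint_cases pole_properties(4)[OF u] by metis
next
  case (3 j)
  then show ?thesis using waypoint_cases transverse_properties(3)[OF u] by metis
next
  case (4 j)
  then have "Suc j < r" using i by auto
  then show ?thesis using 4 waypoint_cases pole_properties(4)[OF u] by metis
qed

lemma polyline_waypoint_nonzero:
  assumes "u \<in> tuples" "u \<in> stratum S" "t \<in> {0..1}"
  shows "polyline (4 * (r - 1)) (waypoint S u) (real (4 * (r - 1)) * t) \<noteq> 0"
proof (rule polyline_nonzero)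
  show "real (4 * (r - 1)) * t \<le> real (4 * (r - 1))"
    using assms(3) by (simp add: mult_left_le)
qed (use assms waypoint_avoids_0 r2 in auto)

lemma planner_in_unit_tangent_sphere:
  assumes "u \<in> tuples" "u \<in> stratum S" "t \<in> {0..1}"
  shows "planner S (u, t) \<in> unit_tangent_sphere"
proof -
  let ?y = "polyline (4 * (r - 1)) (waypoint S u) (real (4 * (r - 1)) * t)"
  have "base u \<bullet> ?y = 0"
    unfolding polyline_def inner_sum_right
    using base_inner_waypoint[OF assms(1,2)] by (intro sum.neutral) simp
  then have "base u \<bullet> sgn ?y = 0" by (simp add: sgn_div_norm)
  moreover have "norm (sgn ?y) = 1"
    using polyline_waypoint_nonzero[OF assms] by (simp add: norm_sgn)
  ultimately show ?thesis
    using tuplesD(1)[OF assms(1), of 0] r2 by (simp add: planner_def unit_tangent_sphere_def norm_eq_1)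
qed

lemma planner_eval:
  assumes u: "u \<in> tuples" and j: "j < r"
  shows "planner S (u, real j / real (r - 1)) = u j"
proof -
  have "real (4 * (r - 1)) * (real j / real (r - 1)) = real (4 * j)"
  proof -
    have "real (r - 1) \<noteq> 0" using r2 by simp
    then have "real (r - 1) * (real j / real (r - 1)) = real j"
      unfolding times_divide_eq_right by (rule nonzero_mult_div_cancel_left)
    then show ?thesis by (simp only: of_nat_mult mult.assoc)
  qed
  moreover have "polyline (4 * (r - 1)) (waypoint S u) (real (4 * j)) = dir u j"
    using polyline_vertex[of "4 * j" "4 * (r - 1)" "waypoint S u"] waypoint_cases(1) j by simp
  moreover have "sgn (dir u j) = dir u j"
    using tuplesD(2)[OF u j] by (simp add: sgn_div_norm)
  moreover have "base u = fst (u j)" using tuples_component(2)[OF u j] by simp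
  ultimately show ?thesis by (simp only: planner_def prod.case prod.collapse)
qed

lemma continuous_on_planner: "continuous_on ((tuples \<inter> stratum S) \<times> {0..1}) (planner S)"
proof -
  let ?D = "(tuples \<inter> stratum S) \<times> {0..1::real}"
  have c: "continuous_on ?D (\<lambda>x. fst x j)" for j
    by (rule continuous_on_product_then_coordinatewise[OF continuous_on_fst[OF continuous_on_id]])
  have cb: "continuous_on ?D (\<lambda>x. base (fst x))" and cv: "continuous_on ?D (\<lambda>x. dir (fst x) j)" for j
    using c by (auto intro: continuous_on_fst continuous_on_snd)
  have K: "continuous_on ?D (\<lambda>x. (if 0 \<in> S then J else I) (base (fst x)))"
    using bounded_linear.continuous_on[OF bounded(1) cb] bounded_linear.continuous_on[OF bounded(2) cb] by simp
  have cn: "continuous_on ?D (\<lambda>x. transverse S (fst x))"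
    unfolding transverse_def Let_def
    by (intro continuous_on_diff continuous_on_scaleR continuous_on_inner K cv)
  have cp: "continuous_on ?D (\<lambda>x. pole S (fst x) j)" for j
    unfolding pole_def using cv[of 0] continuous_on_minus[OF cv[of 0]]
    by (cases "j \<in> S \<and> j \<noteq> 0") (simp_all only: if_True if_False simp_thms)
  have cw: "continuous_on ?D (\<lambda>x. waypoint S (fst x) i)" for i
  proof (cases i rule: index_mod4_cases)
    case (1 j) then show ?thesis using cv by (simp only: waypoint_cases)
  next
    case (2 j) then show ?thesis using cp by (simp only: waypoint_cases)
  next
    case (3 j) then show ?thesis using cn by (simp only: waypoint_cases)
  next
    case (4 j) then show ?thesis using cp by (simp only: waypoint_cases)
  qed
  have "continuous_on ?D (\<lambda>x. polyline (4 * (r - 1)) (waypoint S (fst x)) (real (4 * (r - 1)) * snd x))"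
    unfolding polyline_def hat_def
    by (intro continuous_on_sum continuous_on_scaleR cw continuous_on_max continuous_on_const continuous_on_diff
        continuous_on_rabs continuous_on_mult continuous_on_snd continuous_on_id)
  then have "continuous_on ?D (\<lambda>x. sgn (polyline (4 * (r - 1)) (waypoint S (fst x)) (real (4 * (r - 1)) * snd x)))"
    by (rule continuous_on_sgn) (use polyline_waypoint_nonzero in auto)
  then show ?thesis
    unfolding planner_def case_prod_unfold by (intro continuous_on_Pair cb)
qed

section \<open>Openness of the domains, local sections and the upper bound\<close>

abbreviation E :: "((real ^ 'n) \<times> (real ^ 'n)) topology" where
  "E \<equiv> top_of_set unit_tangent_sphere"

abbreviation X :: "(nat \<Rightarrow> (real ^ 'n) \<times> (real ^ 'n)) topology" where
  "X \<equiv> fibre_power r E unit_tangent_proj"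

lemma topspace_X:
  assumes "u \<in> topspace X"
  shows "u \<in> tuples"
proof (rule tuplesI)
  have "u \<in> (\<Pi>\<^sub>E i\<in>{..<r}. unit_tangent_sphere)"
    and eq: "\<forall>i<r. \<forall>j<r. unit_tangent_proj (u i) = unit_tangent_proj (u j)"
    using assms
    unfolding fibre_power_def topspace_subtopology topspace_product_topology topspace_euclidean_subtopology
    by blast+
  then show "u j \<in> unit_tangent_sphere" if "j < r" for j
    using that by blast
  show "fst (u j) = base u" if "j < r" for j
    using eq that r2 unfolding unit_tangent_proj_def case_prod_unfold by (metis le_less_trans zero_le)
qed

text \<open>Replacing \<open>undefined\<close> by zero, a tuple becomes a point of the product over all indices, where the
  type-class topology is available.\<close>

definition total :: "(nat \<Rightarrow> (real ^ 'n) \<times> (real ^ 'n)) \<Rightarrow> nat \<Rightarrow> (real ^ 'n) \<times> (real ^ 'n)" where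
  "total u = (\<lambda>j. if j < r then u j else 0)"

lemma total_tuples:
  assumes "u \<in> tuples"
  shows "total u \<in> tuples"
proof (rule tuplesI)
  fix j assume "j < r"
  then show "total u j \<in> unit_tangent_sphere" "fst (total u j) = base (total u)"
    using tuples_component[OF assms, of j] r2 by (simp_all add: total_def)
qed

lemma total_stratum: "S \<subseteq> {..<r} \<Longrightarrow> u \<in> stratum S \<Longrightarrow> total u \<in> stratum S"
proof -
  assume S: "S \<subseteq> {..<r}" and u: "u \<in> stratum S"
  have "obstruction j (total u) = obstruction j u" if "j < r" for j
    using that r2 by (simp add: obstruction_def total_def)
  then show ?thesis using S u by (simp add: stratum_def subset_iff)
qed

lemma continuous_map_component: "j < r \<Longrightarrow> continuous_map X euclidean (\<lambda>u. u j)"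
  unfolding fibre_power_def
  by (rule continuous_map_from_subtopology, rule continuous_map_into_fulltopology[of _ _ unit_tangent_sphere],
      rule continuous_map_product_projection) auto

lemma continuous_map_total: "continuous_map X euclidean total"
  unfolding euclidean_product_topology[symmetric] continuous_map_componentwise_UNIV
proof
  fix j
  show "continuous_map X euclidean (\<lambda>u. total u j)"
    using continuous_map_component[of j] by (cases "j < r") (simp_all add: total_def)
qed

text \<open>A stratum is cut out by finitely many strict inequalities between continuous
  functions.\<close>

lemma openin_stratum:
  assumes S: "S \<subseteq> {..<r}"
  shows "openin X (topspace X \<inter> stratum S)"
proof -
  have r0: "0 < r" using r2 by simp
  have cont: "continuous_map X euclideanreal (obstruction j)" if "j < r" for j
  proof -
    have c: "continuous_on UNIV (\<lambda>u. u k)" for k :: nat and u :: "nat \<Rightarrow> (real ^ 'n) \<times> (real ^ 'n)"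
      by simp
    have b: "continuous_on UNIV (\<lambda>u. base u)" and v: "continuous_on UNIV (\<lambda>u. dir u k)" for k
      by (auto intro: continuous_on_fst continuous_on_snd)
    have "continuous_on UNIV (\<lambda>u. obstruction j u)"
      using bounded_linear.continuous_on[OF bounded(1) b] v unfolding obstruction_def
      by (cases "j = 0") (auto intro!: continuous_on_power continuous_on_inner continuous_on_divide
          continuous_on_diff continuous_on_const)
    \<comment> \<open>For indices below \<open>r\<close> the obstruction is unchanged by
      \<open>total\<close>, which transfers continuity to the fibre product.\<close>
    then have "continuous_map X euclideanreal (obstruction j \<circ> total)"
      by (intro continuous_map_compose[OF continuous_map_total]) simp
    moreover have "obstruction j \<circ> total = obstruction j"
      using that r0 by (simp add: fun_eq_iff obstruction_def total_def)
    ultimately show ?thesis by simp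
  qed
  have 1: "openin X {u \<in> topspace X. f u < g u}"
    if "continuous_map X euclideanreal f" "continuous_map X euclideanreal g" for f g
  proof -
    have "openin X {u \<in> topspace X. g u - f u \<in> {0<..}}"
      by (rule openin_continuous_map_preimage[of X euclideanreal]) (use that in \<open>auto intro: continuous_map_diff\<close>)
    then show ?thesis by simp
  qed
  have fin: "finite S" "finite ({..<r} - S)" using S finite_subset by auto
  have all: "openin X {u \<in> topspace X. \<forall>j\<in>A. P j u}"
    if "finite A" "\<And>j. j \<in> A \<Longrightarrow> openin X {u \<in> topspace X. P j u}" for A :: "'i set" and P
  proof -
    have "{u \<in> topspace X. \<forall>j\<in>A. P j u} = (\<Inter>j\<in>A. {u \<in> topspace X. P j u}) \<inter> topspace X"
      by auto
    then show ?thesis using openin_INT[OF that] by simp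
  qed
  have "topspace X \<inter> stratum S = {u \<in> topspace X. \<forall>j\<in>S. 0 < obstruction j u} \<inter>
      ({u \<in> topspace X. \<forall>j\<in>{..<r} - S. obstruction j u < 1} \<inter>
       {u \<in> topspace X. \<forall>i\<in>S. \<forall>j\<in>{..<r} - S. obstruction j u < obstruction i u})"
    by (auto simp: stratum_def)
  also have "openin X \<dots>"
    using S fin cont by (intro openin_Int all 1) auto
  finally show ?thesis .
qed

lemma has_local_section_stratum:
  assumes S: "S \<subseteq> {..<r}"
  shows "has_local_section r E unit_tangent_proj (topspace X \<inter> stratum S)"
proof (rule has_local_sectionI[where F = "\<lambda>(u, t). planner S (total u, t)"])
  let ?Y = "subtopology X (topspace X \<inter> stratum S)"
  have "continuous_map ?Y (top_of_set (tuples \<inter> stratum S)) total"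
    using continuous_map_from_subtopology[OF continuous_map_total]
      topspace_X total_tuples total_stratum[OF S]
    by (auto simp: continuous_map_in_subtopology)
  then have "continuous_map (prod_topology ?Y (top_of_set {0..1})) (top_of_set (tuples \<inter> stratum S)) (\<lambda>x. total (fst x))"
    using continuous_map_compose[OF continuous_map_fst] by (simp only: o_def)
  then have "continuous_map (prod_topology ?Y (top_of_set {0..1::real}))
      (prod_topology (top_of_set (tuples \<inter> stratum S)) (top_of_set {0..1::real})) (\<lambda>x. (total (fst x), snd x))"
    by (simp only: continuous_map_paired continuous_map_snd simp_thms)
  moreover have "continuous_map (prod_topology (top_of_set (tuples \<inter> stratum S)) (top_of_set {0..1})) E (planner S)"
    using continuous_on_planner[of S] planner_in_unit_tangent_sphere by auto
  ultimately have "continuous_map (prod_topology ?Y (top_of_set {0..1})) E (planner S \<circ> (\<lambda>x. (total (fst x), snd x)))"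
    by (rule continuous_map_compose)
  then show "continuous_map (prod_topology ?Y (top_of_set {0..1})) E (\<lambda>(u, t). planner S (total u, t))"
    by (simp only: o_def case_prod_unfold)
next
  fix u i assume "u \<in> topspace X \<inter> stratum S" and i: "i < r"
  then have "total u \<in> tuples" using topspace_X total_tuples by blast
  then show "(case (u, real i / real (r - 1)) of (u, t) \<Rightarrow> planner S (total u, t)) = u i"
    using planner_eval[OF _ i] i by (simp add: total_def)
qed (use r2 in \<open>auto simp: planner_def unit_tangent_proj_def\<close>)

lemma seq_param_TC_le: "seq_param_TC r E unit_tangent_proj \<le> enat (r + 1)"
proof -
  \<comment> \<open>The cover is numbered from 1, so \<open>U k\<close> collects the choice sets of
    size \<open>k - 1\<close>; the sizes run from 0 to \<open>r\<close>.\<close>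
  define U where "U k = (\<Union>S\<in>{S. S \<subseteq> {..<r} \<and> card S = k - 1}. topspace X \<inter> stratum S)" for k
  have "openin X (U k) \<and> has_local_section r E unit_tangent_proj (U k)" for k
  proof
    show "openin X (U k)"
      unfolding U_def using openin_stratum by (intro openin_Union) auto
    show "has_local_section r E unit_tangent_proj (U k)"
      unfolding U_def
    proof (rule has_local_section_disjoint_Union)
      fix S T assume S: "S \<in> {S. S \<subseteq> {..<r} \<and> card S = k - 1}" and T: "T \<in> {S. S \<subseteq> {..<r} \<and> card S = k - 1}"
        and "S \<noteq> T"
      then have "finite S" "finite T" "card S = card T" by (auto intro: finite_subset)
      then have "\<not> S \<subseteq> T" "\<not> T \<subseteq> S"
        using \<open>S \<noteq> T\<close> card_subset_eq by metis+
      \<comment> \<open>Different sets of equal size each have an element outside the other, and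
        these two elements would impose opposite strict inequalities.\<close>
      then obtain i j where "i \<in> S" "i \<notin> T" "j \<in> T" "j \<notin> S" by blast
      then have "obstruction j u < obstruction i u" "obstruction i u < obstruction j u"
        if "u \<in> stratum S" "u \<in> stratum T" for u
        using that S T by (auto simp: stratum_def)
      then show "(topspace X \<inter> stratum S) \<inter> (topspace X \<inter> stratum T) = {}"
        by (meson disjoint_iff IntD2 less_asym)
    qed (use openin_stratum has_local_section_stratum in auto)
  qed
  moreover have "(\<Union>k\<in>{1..r+1}. U k) = topspace X"
  proof
    show "(\<Union>k\<in>{1..r+1}. U k) \<subseteq> topspace X" by (auto simp: U_def)
    show "topspace X \<subseteq> (\<Union>k\<in>{1..r+1}. U k)"
    proof
      fix u assume u: "u \<in> topspace X"
      \<comment> \<open>Cutting at 1/2 gives obstructions above 1/2 inside \<open>S\<close> and at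
        most 1/2 outside, which yields all three conditions of the stratum.\<close>
      define S where "S = {j. j < r \<and> obstruction j u > 1 / 2}"
      have "u \<in> stratum S" by (auto simp: stratum_def S_def)
      moreover have sub: "S \<subseteq> {..<r}" by (auto simp: S_def)
      ultimately have "u \<in> U (card S + 1)" using u by (auto simp: U_def)
      moreover have "card S + 1 \<in> {1..r+1}" using card_mono[OF _ sub] by simp
      ultimately show "u \<in> (\<Union>k\<in>{1..r+1}. U k)" by blast
    qed
  qed
  ultimately show ?thesis
    unfolding seq_param_TC_def
    by (intro Inf_lower CollectI exI[of _ "r + 1"] conjI refl exI[of _ U] ballI) auto
qed

end


theorem theorem8p10:
  fixes m r :: nat
  assumes "m \<ge> 1"
    and "CARD('n::finite) = 4 * m"
    and "r \<ge> 2"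
  shows "seq_param_TC r
           (top_of_set (unit_tangent_sphere :: ((real ^ 'n) \<times> (real ^ 'n)) set))
           (unit_tangent_proj :: (real ^ 'n) \<times> (real ^ 'n) \<Rightarrow> real ^ 'n)
         = enat (r + 1)"
proof (rule antisym)
  obtain I J :: "real ^ 'n \<Rightarrow> real ^ 'n" where IJ: "linear I" "linear J"
    "\<And>x. I x \<bullet> x = 0" "\<And>x. J x \<bullet> x = 0" "\<And>x. I x \<bullet> J x = 0"
    "\<And>x. norm (I x) = norm x" "\<And>x. norm (J x) = norm x"
    using quaternionic_fields[OF assms(2)] by blast
  interpret quaternionic_sphere I J r
    by (rule quaternionic_sphere.intro[OF IJ assms(3)])
  show "seq_param_TC r (top_of_set unit_tangent_sphere) (unit_tangent_proj :: (real ^ 'n) \<times> (real ^ 'n) \<Rightarrow> real ^ 'n)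
      \<le> enat (r + 1)"
    by (rule seq_param_TC_le)
  show "enat (r + 1) \<le> seq_param_TC r (top_of_set unit_tangent_sphere)
      (unit_tangent_proj :: (real ^ 'n) \<times> (real ^ 'n) \<Rightarrow> real ^ 'n)"
    unfolding seq_param_TC_def
  proof (rule Inf_greatest, clarify)
    fix k and U :: "nat \<Rightarrow> (nat \<Rightarrow> (real ^ 'n) \<times> (real ^ 'n)) set"
    assume k: "1 \<le> k"
      and U: "\<forall>i\<in>{1..k}. openin (fibre_power r (top_of_set unit_tangent_sphere) unit_tangent_proj) (U i) \<and>
        has_local_section r (top_of_set unit_tangent_sphere) unit_tangent_proj (U i)"
      and cov: "(\<Union>i\<in>{1..k}. U i) = topspace (fibre_power r (top_of_set unit_tangent_sphere) unit_tangent_proj)"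
    \<comment> \<open>Even ambient dimension makes the tangent spaces odd-dimensional, so the lower
      bound rules out covers by at most \<open>r\<close> sets.\<close>
    have "even CARD('n)" using assms(2) by simp
    then have "\<not> k \<le> r"
      using section_cover_unit_tangent_False[OF _ assms(3) k, of U] U cov by blast
    then show "enat (r + 1) \<le> enat k" by simp
  qed
qed

end
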